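(* Let $p$ be a prime and let $G$ be a finite $p$-group. Suppose that $\psi,\varphi\in\operatorname{Irr}(G)$ are faithful and that $\psi\varphi=m\chi$ for some positive integer $m$ and some $\chi\in\operatorname{Irr}(G)$. Then $\psi$ and $\varphi$ are fully ramified with respect to $\mathbf{Z}(G)$; equivalently, $\psi$ and $\varphi$ vanish on $G-\mathbf{Z}(G)$.
   Context: $\operatorname{Irr}(G)$ is the set of irreducible complex characters of the finite group $G$, and $\mathbf{Z}(G)$ is the center of $G$. A character is faithful if its kernel is trivial. A character $\theta\in\operatorname{Irr}(G)$ is fully ramified with respect to $\mathbf{Z}(G)$ if $\theta(1)^2=|G:\mathbf{Z}(G)|$; this is equivalent to $\theta(g)=0$ for all $g\in G-\mathbf{Z}(G)$. *)

theory Defs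
  imports
    "HOL-Computational_Algebra.Primes"
    "HOL-Algebra.Coset"
    "Jordan_Normal_Form.VS_Connect"
begin

text \<open>A complex representation of degree \<open>n\<close> is a homomorphism into the group
  \<open>GL\<^sub>n(\<complex>)\<close>, the unit group of the ring of complex \<open>n \<times> n\<close> matrices.\<close>

definition representation :: "('a, 'c) monoid_scheme \<Rightarrow> nat \<Rightarrow> ('a \<Rightarrow> complex mat) \<Rightarrow> bool" where
  "representation G n \<rho> \<longleftrightarrow> \<rho> \<in> hom G (units_of (ring_mat TYPE(complex) n ()))"

definition irreducible_representation ::
    "('a, 'c) monoid_scheme \<Rightarrow> nat \<Rightarrow> ('a \<Rightarrow> complex mat) \<Rightarrow> bool" where
  "irreducible_representation G n \<rho> \<longleftrightarrow>
     representation G n \<rho> \<and> n > 0 \<and>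
     (\<forall>W. VectorSpace.subspace class_ring W (module_vec TYPE(complex) n) \<longrightarrow>
          (\<forall>g\<in>carrier G. \<forall>v\<in>W. \<rho> g *\<^sub>v v \<in> W) \<longrightarrow>
          W = {0\<^sub>v n} \<or> W = carrier_vec n)"

definition mat_trace :: "complex mat \<Rightarrow> complex" where
  "mat_trace A = (\<Sum>i<dim_row A. A $$ (i, i))"

text \<open>Characters are functions on \<open>carrier G\<close>; \<^const>\<open>restrict\<close> makes them
  \<^const>\<open>undefined\<close> elsewhere, so that equality of characters is equality on \<open>G\<close>.\<close>

definition Irr :: "('a, 'c) monoid_scheme \<Rightarrow> ('a \<Rightarrow> complex) set" where
  "Irr G = {\<lambda>g\<in>carrier G. mat_trace (\<rho> g) | n \<rho>. irreducible_representation G n \<rho>}"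

definition char_kernel :: "('a, 'c) monoid_scheme \<Rightarrow> ('a \<Rightarrow> complex) \<Rightarrow> 'a set" where
  "char_kernel G \<chi> = {g \<in> carrier G. \<chi> g = \<chi> \<one>\<^bsub>G\<^esub>}"

definition faithful_char :: "('a, 'c) monoid_scheme \<Rightarrow> ('a \<Rightarrow> complex) \<Rightarrow> bool" where
  "faithful_char G \<chi> \<longleftrightarrow> char_kernel G \<chi> = {\<one>\<^bsub>G\<^esub>}"

definition group_center :: "('a, 'c) monoid_scheme \<Rightarrow> 'a set" where
  "group_center G = {z \<in> carrier G. \<forall>g\<in>carrier G. z \<otimes>\<^bsub>G\<^esub> g = g \<otimes>\<^bsub>G\<^esub> z}"

definition fully_ramified :: "('a, 'c) monoid_scheme \<Rightarrow> ('a \<Rightarrow> complex) \<Rightarrow> bool" where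
  "fully_ramified G \<theta> \<longleftrightarrow> (\<theta> \<one>\<^bsub>G\<^esub>)\<^sup>2 = of_nat (card (rcosets\<^bsub>G\<^esub> (group_center G)))"

end

theory Submission
  imports Defs
    "HOL-Algebra.Multiplicative_Group"
    "HOL-Algebra.Group_Action"
    "HOL-Number_Theory.Cong"
    "Jordan_Normal_Form.Spectral_Radius"
    "Jordan_Normal_Form.Matrix_Kernel"
begin

text \<open>Write \<open>Z\<close> for the centre, and \<open>\<lambda>\<close>, \<open>\<mu>\<close> for the linear characters of \<open>Z\<close> below \<open>\<psi>\<close>,
  \<open>\<phi>\<close>. Since \<open>\<psi>\<phi> = m\<chi>\<close> with \<open>\<chi>\<close> irreducible, class sums act as scalars on the tensor product, which
  gives, for every conjugation-invariant set \<open>Y\<close> and every \<open>g\<close>,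
  \<open>\<Sum>\<^sub>y \<psi>(g y) \<phi>(g y\<^sup>k) = \<chi>(g)/\<chi>(1) \<Sum>\<^sub>y \<psi>(y) \<phi>(y\<^sup>k)\<close>.
  As \<open>\<lambda>\<close> and \<open>\<mu>\<close> are faithful, \<open>k\<close> can be chosen with \<open>\<lambda>\<mu>\<^sup>k = 1\<close>; if \<open>Z \<noteq> G\<close> then neither \<open>k\<close> nor
  \<open>1 - k\<close> is divisible by \<open>p\<close>. Going up a central series of normal subgroups \<open>E \<supseteq> Z\<close>, one
  shows that \<open>\<chi>(g) \<noteq> 0\<close> and \<open>b \<in> E - Z\<close> imply \<open>\<psi>(g b) = \<phi>(g b) = 0\<close>: in the sum over a coset
  \<open>Y = b E\<close> that is central in \<open>G/E\<close>, with \<open>g\<close> shifted by \<open>b\<^sup>-\<^sup>k\<close> or \<open>b\<^sup>-\<^sup>1\<close>, only the equal terms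
  with \<open>y \<in> b Z\<close> survive. For \<open>E = G\<close> and \<open>g = 1\<close> this is the theorem.\<close>

section \<open>Relative centres in finite groups\<close>

context group
begin

lemma mult_inv_cancel:
  assumes "x \<in> carrier G" "y \<in> carrier G"
  shows "inv x \<otimes> (x \<otimes> y) = y" "x \<otimes> (inv x \<otimes> y) = y"
  using assms by (simp_all add: m_assoc[symmetric])

lemma conj_nat_pow:
  assumes "h \<in> carrier G" "y \<in> carrier G"
  shows "(h \<otimes> y \<otimes> inv h) [^] (k::nat) = h \<otimes> y [^] k \<otimes> inv h"
  using assms by (induction k) (simp_all add: m_assoc mult_inv_cancel)

lemma nat_pow_cong_order:
  assumes "finite (carrier G)" "x \<in> carrier G" "[k = l] (mod Coset.order G)"
  shows "x [^] (k::nat) = x [^] l"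
proof -
  have "x [^] i = x [^] (i mod Coset.order G)" for i :: nat
  proof -
    have "x [^] i = x [^] (Coset.order G * (i div Coset.order G) + i mod Coset.order G)" by simp
    also have "\<dots> = (x [^] Coset.order G) [^] (i div Coset.order G) \<otimes> x [^] (i mod Coset.order G)"
      using assms(2) by (simp add: nat_pow_mult nat_pow_pow)
    finally show ?thesis using assms(1,2) by (simp add: pow_order_eq_1)
  qed
  then show ?thesis using assms(3) unfolding cong_def by metis
qed

lemma subgroup_center: "subgroup (group_center G) G"
proof
  fix x y assume "x \<in> group_center G" "y \<in> group_center G"
  then have cl: "x \<in> carrier G" "y \<in> carrier G"
    and comm: "\<And>g. g \<in> carrier G \<Longrightarrow> x \<otimes> g = g \<otimes> x" "\<And>g. g \<in> carrier G \<Longrightarrow> y \<otimes> g = g \<otimes> y"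
    by (auto simp: group_center_def)
  have "x \<otimes> y \<otimes> g = g \<otimes> (x \<otimes> y)" if g: "g \<in> carrier G" for g
  proof -
    have "x \<otimes> y \<otimes> g = x \<otimes> (g \<otimes> y)" using cl g comm(2)[OF g] by (simp add: m_assoc)
    also have "\<dots> = (g \<otimes> x) \<otimes> y" using cl g comm(1)[OF g] by (simp add: m_assoc[symmetric])
    finally show ?thesis using cl g by (simp add: m_assoc)
  qed
  then show "x \<otimes> y \<in> group_center G" using cl by (simp add: group_center_def)
next
  fix x assume "x \<in> group_center G"
  then have cl: "x \<in> carrier G"
    and comm: "\<And>g. g \<in> carrier G \<Longrightarrow> x \<otimes> g = g \<otimes> x"
    by (auto simp: group_center_def)
  have "inv x \<otimes> g = g \<otimes> inv x" if g: "g \<in> carrier G" for g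
    using arg_cong[OF comm[of "inv g"], of "m_inv G"] g cl by (simp add: inv_mult_group)
  then show "inv x \<in> group_center G" using cl by (simp add: group_center_def)
qed (auto simp: group_center_def)

lemma normal_center: "group_center G \<lhd> G"
proof (unfold normal_inv_iff, intro conjI subgroup_center ballI)
  fix x h assume "x \<in> carrier G" "h \<in> group_center G"
  then have "h \<in> carrier G" "x \<otimes> h = h \<otimes> x" by (auto simp: group_center_def)
  then have "x \<otimes> h \<otimes> inv x = h" using \<open>x \<in> carrier G\<close> by (simp add: m_assoc)
  then show "x \<otimes> h \<otimes> inv x \<in> group_center G" using \<open>h \<in> group_center G\<close> by simp
qed

text \<open>Class equation: conjugacy classes have \<open>p\<close>-power size, and those of size
  one are central. If only \<open>\<one>\<close> were central, \<open>p ^ a\<close> would be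
  \<open>1\<close> plus a multiple of \<open>p\<close>.\<close>

lemma p_group_center_nontrivial:
  assumes p: "prime p" and ord: "Coset.order G = p ^ a" "a > 0"
  shows "\<exists>z\<in>group_center G. z \<noteq> \<one>"
proof (rule ccontr)
  assume no: "\<not> ?thesis"
  define act where "act = (\<lambda>g. \<lambda>h\<in>carrier G. g \<otimes> h \<otimes> inv g)"
  interpret act: group_action G "carrier G" act
    unfolding act_def by (rule action_by_conjugation)
  have fin: "finite (carrier G)"
    using ord p by (metis order_gt_0_iff_finite prime_gt_0_nat zero_less_power)
  define Orb where "Orb = orbits G (carrier G) act"
  have "orbit G act \<one> = {\<one>}"
    by (auto simp: orbit_def act_def intro!: exI[of _ "\<one>"])
  then have O1: "{\<one>} \<in> Orb"
    unfolding Orb_def orbits_def by blast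
  have finO: "finite Orb" unfolding Orb_def orbits_def using fin by simp
  have dvd: "p dvd card X" if X: "X \<in> Orb - {{\<one>}}" for X
  proof -
    obtain x where x: "x \<in> carrier G" "X = orbit G act x"
      using X by (auto simp: Orb_def orbits_def)
    have xX: "x \<in> X" using act.orbit_refl x by simp
    have "card X dvd p ^ a"
      using act.orbit_stabilizer_theorem[OF x(1)] x(2) ord by (metis dvd_triv_left)
    then obtain i where i: "card X = p ^ i" using divides_primepow_nat[OF p] by blast
    have "i \<noteq> 0"
    proof
      assume "i = 0"
      then have X1: "X = {x}" using i xX by (metis card_1_singletonE power_0 singletonD)
      have "x \<in> group_center G"
        unfolding group_center_def
      proof (intro CollectI conjI ballI x(1))
        fix g assume g: "g \<in> carrier G"
        have "act g x \<in> X" unfolding x(2) orbit_def using g by blast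
        then have "g \<otimes> x \<otimes> inv g = x" using X1 x g by (simp add: act_def)
        then show "x \<otimes> g = g \<otimes> x" using g x inv_solve_right' by (metis m_closed)
      qed
      then have "x = \<one>" using no by blast
      then show False using X X1 by simp
    qed
    then show ?thesis using i by (simp add: dvd_power)
  qed
  have "p ^ a = (\<Sum>X\<in>Orb. card X)"
    using act.disjoint_sum[OF fin, of "\<lambda>_. 1::nat"] ord by (simp add: Orb_def Coset.order_def)
  also have "\<dots> = 1 + (\<Sum>X\<in>Orb - {{\<one>}}. card X)"
    using sum.remove[OF finO O1, of card] by simp
  finally have "p dvd 1 + (\<Sum>X\<in>Orb - {{\<one>}}. card X)"
    using ord(2) by (metis dvd_power)
  moreover have "p dvd (\<Sum>X\<in>Orb - {{\<one>}}. card X)" by (intro dvd_sum dvd)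
  ultimately have "p dvd 1" by (metis dvd_add_left_iff)
  then show False using p by simp
qed

text \<open>The power rule of the quotient group \<open>G Mod E\<close>, spelled out on
  representatives.\<close>

lemma coset_nat_pow:
  assumes "E \<lhd> G" "b \<in> carrier G" "e \<in> E"
  shows "\<exists>e'\<in>E. (b \<otimes> e) [^] (k::nat) = b [^] k \<otimes> e'"
proof (induction k)
  case 0
  interpret normal E G by fact
  show ?case by auto
next
  case (Suc k)
  interpret normal E G by fact
  from Suc obtain e' where e': "e' \<in> E" "(b \<otimes> e) [^] k = b [^] k \<otimes> e'" by blast
  have "(b \<otimes> e) [^] Suc k = b [^] Suc k \<otimes> ((inv b \<otimes> e' \<otimes> b) \<otimes> e)"
    using assms e' by (simp add: m_assoc mult_inv_cancel)
  moreover have "(inv b \<otimes> e' \<otimes> b) \<otimes> e \<in> E"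
    using inv_op_closed1[OF assms(2) e'(1)] assms(3) by simp
  ultimately show ?case by blast
qed

lemma subgroup_nat_pow_closed:
  assumes "subgroup E G" "x \<in> E"
  shows "x [^] (k::nat) \<in> E"
  using assms by (induction k) (simp_all add: subgroup.one_closed subgroup.m_closed)

lemma center_nat_pow_closed:
  "z \<in> group_center G \<Longrightarrow> z [^] (k::nat) \<in> group_center G"
  by (induction k)
    (simp_all add: subgroup.one_closed[OF subgroup_center] subgroup.m_closed[OF subgroup_center])

text \<open>The preimage in \<open>G\<close> of the centre of \<open>G/E\<close>.\<close>

definition relative_center :: "'a set \<Rightarrow> 'a set" where
  "relative_center E = {a \<in> carrier G. \<forall>h\<in>carrier G. h \<otimes> a \<otimes> inv h \<otimes> inv a \<in> E}"

lemma subset_relative_center: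
  assumes "E \<lhd> G"
  shows "E \<subseteq> relative_center E"
proof -
  interpret normal E G by fact
  show ?thesis unfolding relative_center_def using inv_op_closed2 m_inv_closed m_closed subset by auto
qed

lemma relative_center_normal:
  assumes "E \<lhd> G"
  shows "relative_center E \<lhd> G"
proof -
  interpret E: normal E G by fact
  have comm: "x \<otimes> a \<otimes> inv x \<otimes> inv a \<in> E" "a \<in> carrier G"
    if "a \<in> relative_center E" "x \<in> carrier G" for a x
    using that by (auto simp: relative_center_def)
  have "subgroup (relative_center E) G"
  proof
    fix a b assume ab: "a \<in> relative_center E" "b \<in> relative_center E"
    then have cl: "a \<in> carrier G" "b \<in> carrier G" by (auto simp: relative_center_def)
    have "h \<otimes> (a \<otimes> b) \<otimes> inv h \<otimes> inv (a \<otimes> b) \<in> E" if h: "h \<in> carrier G" for h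
    proof -
      \<comment> \<open>Commutator identity \<open>[h, ab] = [h, a] a [h, b] inv a\<close>, with
        \<open>[h, a] = h a inv h inv a\<close>.\<close>
      have "h \<otimes> a \<otimes> inv h \<otimes> inv a \<otimes> (a \<otimes> (h \<otimes> b \<otimes> inv h \<otimes> inv b) \<otimes> inv a) \<in> E"
        using comm(1)[OF ab(1) h] comm(1)[OF ab(2) h] E.inv_op_closed2[OF cl(1)] by simp
      then show ?thesis using h cl by (simp add: m_assoc mult_inv_cancel inv_mult_group)
    qed
    then show "a \<otimes> b \<in> relative_center E" using cl by (simp add: relative_center_def)
  next
    fix a assume a: "a \<in> relative_center E"
    then have cl: "a \<in> carrier G" by (auto simp: relative_center_def)
    have "h \<otimes> inv a \<otimes> inv h \<otimes> inv (inv a) \<in> E" if h: "h \<in> carrier G" for h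
    proof -
      \<comment> \<open>Here \<open>[h, inv a]\<close> is the inverse of the conjugate
        \<open>inv a [h, a] a\<close>.\<close>
      have "inv (inv a \<otimes> (h \<otimes> a \<otimes> inv h \<otimes> inv a) \<otimes> inv (inv a)) \<in> E"
        using comm(1)[OF a h] E.inv_op_closed2[of "inv a"] cl E.m_inv_closed by simp
      then show ?thesis using h cl by (simp add: m_assoc mult_inv_cancel inv_mult_group)
    qed
    then show "inv a \<in> relative_center E" using cl by (simp add: relative_center_def)
  qed (auto simp: relative_center_def)
  moreover have "x \<otimes> a \<otimes> inv x \<in> relative_center E"
    if x: "x \<in> carrier G" and a: "a \<in> relative_center E" for x a
  proof -
    have cl: "a \<in> carrier G" using a by (auto simp: relative_center_def)
    have "h \<otimes> (x \<otimes> a \<otimes> inv x) \<otimes> inv h \<otimes> inv (x \<otimes> a \<otimes> inv x) \<in> E" if h: "h \<in> carrier G" for h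
    proof -
      \<comment> \<open>Conjugating by \<open>x\<close> turns \<open>[inv x h x, a]\<close> into
        \<open>[h, x a inv x]\<close>.\<close>
      have "x \<otimes> ((inv x \<otimes> h \<otimes> x) \<otimes> a \<otimes> inv (inv x \<otimes> h \<otimes> x) \<otimes> inv a) \<otimes> inv x \<in> E"
        using comm(1)[OF a, of "inv x \<otimes> h \<otimes> x"] E.inv_op_closed2[OF x] x h by simp
      then show ?thesis using h x cl by (simp add: m_assoc mult_inv_cancel inv_mult_group)
    qed
    then show ?thesis using x cl by (simp add: relative_center_def)
  qed
  ultimately show ?thesis by (simp add: normal_inv_iff)
qed

text \<open>A proper normal \<open>E\<close> gives a nontrivial \<open>p\<close>-group
  \<open>G Mod E\<close>; a nontrivial central coset lifts to the required element. This keeps the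
  central series growing until it reaches \<open>G\<close>.\<close>

lemma p_group_relative_center_larger:
  assumes p: "prime p" and ord: "Coset.order G = p ^ a"
    and E: "E \<lhd> G" "E \<noteq> carrier G"
  shows "\<exists>b\<in>relative_center E. b \<notin> E"
proof -
  interpret E: normal E G by fact
  interpret Q: group "G Mod E" by (rule E.factorgroup_is_group)
  have fin: "finite (carrier G)"
    using ord p by (metis order_gt_0_iff_finite prime_gt_0_nat zero_less_power)
  have "card (rcosets E) * card E = p ^ a"
    using lagrange[OF E.is_subgroup] ord by simp
  then obtain i where i: "card (rcosets E) = p ^ i"
    using divides_primepow_nat[OF p] by (metis dvd_triv_left)
  then have ordQ: "Coset.order (G Mod E) = p ^ i" by (simp add: Coset.order_def FactGroup_def)
  have "i > 0"
  proof (rule ccontr)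
    assume "\<not> i > 0"
    then have "card E = card (carrier G)"
      using lagrange[OF E.is_subgroup] i by (simp add: Coset.order_def)
    then show False using E(2) E.subset fin by (metis card_subset_eq)
  qed
  from Q.p_group_center_nontrivial[OF p ordQ this]
  obtain z where z: "z \<in> group_center (G Mod E)" "z \<noteq> \<one>\<^bsub>G Mod E\<^esub>" by blast
  then obtain b where b: "b \<in> carrier G" "z = E #> b"
    by (auto simp: group_center_def FactGroup_def RCOSETS_def)
  have "h \<otimes> b \<otimes> inv h \<otimes> inv b \<in> E" if h: "h \<in> carrier G" for h
  proof -
    have "E #> h \<in> carrier (G Mod E)" using h by (auto simp: FactGroup_def RCOSETS_def)
    then have "(E #> b) <#> (E #> h) = (E #> h) <#> (E #> b)"
      using z(1) by (simp add: group_center_def b(2) FactGroup_def)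
    then have "E #> (b \<otimes> h) = E #> (h \<otimes> b)" using h b by (simp add: E.rcos_sum)
    then have "h \<otimes> b \<in> E #> (b \<otimes> h)" using h b rcos_self[OF _ E.is_subgroup, of "h \<otimes> b"] by simp
    then have "(h \<otimes> b) \<otimes> inv (b \<otimes> h) \<in> E"
      using E.rcos_module[OF is_group] h b by simp
    then show ?thesis using h b by (simp add: m_assoc inv_mult_group)
  qed
  moreover have "b \<notin> E"
  proof
    assume "b \<in> E"
    then have "E #> b = E" using coset_join2 E.is_subgroup b(1) by blast
    then show False using z(2) b(2) by (simp add: FactGroup_def)
  qed
  ultimately show ?thesis using b(1) by (auto simp: relative_center_def)
qed

end

section \<open>Orthogonality relations for matrix coefficients\<close>

lemma mat_trace_mult:
  assumes "A \<in> carrier_mat n n" "B \<in> carrier_mat n n"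
  shows "mat_trace (A * B) = (\<Sum>i<n. \<Sum>j<n. A $$ (i,j) * B $$ (j,i))"
  using assms by (simp add: mat_trace_def scalar_prod_def atLeast0LessThan)

lemma mat_trace_comm:
  assumes "A \<in> carrier_mat n n" "B \<in> carrier_mat n n"
  shows "mat_trace (A * B) = mat_trace (B * A)"
  unfolding mat_trace_mult[OF assms] mat_trace_mult[OF assms(2,1)]
  by (subst sum.swap) (simp add: mult.commute)

lemma eq_zero_mat_if_kernel_full:
  fixes A :: "'a::comm_ring_1 mat"
  assumes A: "A \<in> carrier_mat n n" and K: "mat_kernel A = carrier_vec n"
  shows "A = 0\<^sub>m n n"
proof (rule eq_matI)
  fix i j assume ij: "i < dim_row (0\<^sub>m n n :: 'a mat)" "j < dim_col (0\<^sub>m n n :: 'a mat)"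
  have "unit_vec n j \<in> mat_kernel A" using K by simp
  then have z: "A *\<^sub>v unit_vec n j = 0\<^sub>v n" using mat_kernelD(2)[OF A] by blast
  have "A $$ (i,j) = (A *\<^sub>v unit_vec n j) $ i"
    using ij A by simp
  then show "A $$ (i,j) = 0\<^sub>m n n $$ (i,j)" using z ij by simp
qed (use A in auto)

lemma subspace_mat_kernel:
  fixes A :: "complex mat"
  assumes A: "A \<in> carrier_mat n n"
  shows "VectorSpace.subspace class_ring (mat_kernel A) (module_vec TYPE(complex) n)"
  unfolding VectorSpace.subspace_def submodule_def
  using vec_vs vec_module A mult_add_distrib_mat_vec[OF A] mult_mat_vec[OF A]
  by (auto simp: mat_kernel[OF A] module_vec_def class_ring_simps)

locale irreducible_rep = group G for G (structure) +
  fixes n :: nat and \<rho> :: "'a \<Rightarrow> complex mat"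
  assumes irred: "irreducible_representation G n \<rho>"
    and fin: "finite (carrier G)"
begin

abbreviation "N \<equiv> of_nat (Coset.order G) :: complex"

lemma n_pos: "n > 0"
  using irred by (simp add: irreducible_representation_def)

lemma rho_hom: "\<rho> \<in> hom G (units_of (ring_mat TYPE(complex) n ()))"
  using irred by (simp add: irreducible_representation_def representation_def)

lemma rho_closed [simp]: "g \<in> carrier G \<Longrightarrow> \<rho> g \<in> carrier_mat n n"
  using rho_hom by (auto simp: hom_def Pi_iff units_of_def Units_def ring_mat_simps)

lemma rho_dim [simp]: "g \<in> carrier G \<Longrightarrow> dim_row (\<rho> g) = n" "g \<in> carrier G \<Longrightarrow> dim_col (\<rho> g) = n"
  using rho_closed by fastforce+

lemma rho_mult: "g \<in> carrier G \<Longrightarrow> h \<in> carrier G \<Longrightarrow> \<rho> (g \<otimes> h) = \<rho> g * \<rho> h"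
  using hom_mult[OF rho_hom] by (simp add: units_of_def ring_mat_simps)

lemma rho_one: "\<rho> \<one> = 1\<^sub>m n"
proof -
  interpret M: ring "ring_mat TYPE(complex) n ()" by (rule ring_mat)
  have "\<rho> \<one> = \<one>\<^bsub>units_of (ring_mat TYPE(complex) n ())\<^esub>"
    using hom_one[OF rho_hom is_group M.units_group] .
  then show ?thesis by (simp add: units_of_def ring_mat_simps)
qed

lemma rho_mult_entry:
  "g \<in> carrier G \<Longrightarrow> h \<in> carrier G \<Longrightarrow> i < n \<Longrightarrow> j < n \<Longrightarrow>
    \<rho> (g \<otimes> h) $$ (i,j) = (\<Sum>k<n. \<rho> g $$ (i,k) * \<rho> h $$ (k,j))"
  by (simp add: rho_mult scalar_prod_def atLeast0LessThan)

text \<open>The intertwining relation makes the kernel of \<open>A\<close> invariant, so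
  irreducibility decides. It is applied with \<open>M = \<rho>\<close> for Schur's lemma and with
  adjoint matrices for \<open>trace_inv\<close>.\<close>

lemma kernel_trivial_or_zero:
  assumes A: "A \<in> carrier_mat n n"
    and M: "\<And>g. g \<in> carrier G \<Longrightarrow> M g \<in> carrier_mat n n"
    and AM: "\<And>g. g \<in> carrier G \<Longrightarrow> A * \<rho> g = M g * A"
  shows "mat_kernel A = {0\<^sub>v n} \<or> A = 0\<^sub>m n n"
proof -
  have "\<forall>g\<in>carrier G. \<forall>v\<in>mat_kernel A. \<rho> g *\<^sub>v v \<in> mat_kernel A"
  proof (intro ballI)
    fix g v assume g: "g \<in> carrier G" and "v \<in> mat_kernel A"
    then have v: "v \<in> carrier_vec n" "A *\<^sub>v v = 0\<^sub>v n"
      using mat_kernelD[OF A] by auto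
    have "A *\<^sub>v (\<rho> g *\<^sub>v v) = M g *\<^sub>v (A *\<^sub>v v)"
      using A v(1) rho_closed[OF g] M[OF g] AM[OF g] by (metis assoc_mult_mat_vec)
    also have "\<dots> = 0\<^sub>v n" unfolding v(2) using M[OF g] by (intro eq_vecI) auto
    finally show "\<rho> g *\<^sub>v v \<in> mat_kernel A"
      using A v(1) rho_closed[OF g] by (intro mat_kernelI) auto
  qed
  then have "mat_kernel A = {0\<^sub>v n} \<or> mat_kernel A = carrier_vec n"
    using irred subspace_mat_kernel[OF A] unfolding irreducible_representation_def by blast
  then show ?thesis using eq_zero_mat_if_kernel_full[OF A] by blast
qed

text \<open>For an eigenvalue \<open>c\<close> of \<open>B\<close>, the difference of
  \<open>B\<close> and the scalar matrix of \<open>c\<close> still commutes with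
  \<open>\<rho>\<close> and has an eigenvector in its kernel, hence is zero.\<close>

lemma schur:
  assumes B: "B \<in> carrier_mat n n"
    and comm: "\<And>g. g \<in> carrier G \<Longrightarrow> B * \<rho> g = \<rho> g * B"
  obtains c where "B = c \<cdot>\<^sub>m 1\<^sub>m n"
proof -
  obtain c where "c \<in> spectrum B" using spectrum_non_empty[OF B n_pos] by auto
  then obtain v where v: "v \<in> carrier_vec n" "v \<noteq> 0\<^sub>v n" "B *\<^sub>v v = c \<cdot>\<^sub>v v"
    using B unfolding spectrum_def eigenvalue_def eigenvector_def by auto
  define A where "A = B - c \<cdot>\<^sub>m 1\<^sub>m n"
  have A: "A \<in> carrier_mat n n" unfolding A_def by (intro minus_carrier_mat smult_carrier_mat one_carrier_mat)
  have "A * \<rho> g = \<rho> g * A" if g: "g \<in> carrier G" for g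
    unfolding A_def using rho_closed[OF g] B comm[OF g]
    by (simp add: minus_mult_distrib_mat[of _ n n] mult_minus_distrib_mat[of _ n n]
        mult_smult_distrib[OF _ one_carrier_mat] mult_smult_assoc_mat[of _ n n])
  moreover have "v \<in> mat_kernel A"
    using v B A by (intro mat_kernelI[OF A]) (auto simp: A_def minus_mult_distrib_mat_vec[of _ n n])
  ultimately have "A = 0\<^sub>m n n"
    using kernel_trivial_or_zero[OF A, of \<rho>] v by auto
  then have "B = c \<cdot>\<^sub>m 1\<^sub>m n"
    unfolding A_def using B
    by (intro eq_matI) (metis eq_iff_diff_eq_0 index_minus_mat(1) index_smult_mat(2,3) index_one_mat(2,3)
        carrier_matD index_zero_mat(1) | auto)+
  then show thesis by (rule that)
qed

lemma sum_shift_left: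
  "g \<in> carrier G \<Longrightarrow> (\<Sum>h\<in>carrier G. f (g \<otimes> h)) = (\<Sum>h\<in>carrier G. f h)"
  by (rule sum.reindex_bij_witness[of _ "\<lambda>h. inv g \<otimes> h" "\<lambda>h. g \<otimes> h"])
    (auto simp: m_assoc[symmetric])

text \<open>For fixed \<open>j\<close>, \<open>k\<close> the sums are the entries of the average of
  the matrix unit at \<open>(j,k)\<close> over conjugation by all \<open>\<rho> h\<close>. By
  Schur's lemma this is a scalar matrix, and its trace determines the scalar.\<close>

lemma matrix_coefficients_orthogonal:
  assumes ij: "i < n" "j < n" "k < n" "l < n"
  shows "(\<Sum>h\<in>carrier G. \<rho> h $$ (i,j) * \<rho> (inv h) $$ (k,l)) =
         (if i = l \<and> j = k then N / of_nat n else 0)"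
proof -
  define B where "B = mat n n (\<lambda>(i,l). \<Sum>h\<in>carrier G. \<rho> h $$ (i,j) * \<rho> (inv h) $$ (k,l))"
  have B: "B \<in> carrier_mat n n" by (simp add: B_def)
  have "B * \<rho> g = \<rho> g * B" if g: "g \<in> carrier G" for g
  proof (rule eq_matI)
    fix i l assume "i < dim_row (\<rho> g * B)" "l < dim_col (\<rho> g * B)"
    then have il: "i < n" "l < n" using g by (auto simp: B_def)
    have "(B * \<rho> g) $$ (i,l) = (\<Sum>m<n. (\<Sum>h\<in>carrier G. \<rho> h $$ (i,j) * \<rho> (inv h) $$ (k,m)) * \<rho> g $$ (m,l))"
      using il g by (simp add: B_def scalar_prod_def atLeast0LessThan)
    also have "\<dots> = (\<Sum>h\<in>carrier G. \<rho> h $$ (i,j) * (\<Sum>m<n. \<rho> (inv h) $$ (k,m) * \<rho> g $$ (m,l)))"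
      by (simp add: sum_distrib_left sum_distrib_right mult.assoc) (rule sum.swap)
    also have "\<dots> = (\<Sum>h\<in>carrier G. \<rho> h $$ (i,j) * \<rho> (inv h \<otimes> g) $$ (k,l))"
      using ij il g by (simp add: rho_mult_entry)
    \<comment> \<open>Replacing \<open>h\<close> by \<open>g \<otimes> h\<close> moves
      \<open>g\<close> from the right factor to the left one.\<close>
    also have "\<dots> = (\<Sum>h\<in>carrier G. \<rho> (g \<otimes> h) $$ (i,j) * \<rho> (inv (g \<otimes> h) \<otimes> g) $$ (k,l))"
      using sum_shift_left[OF g, of "\<lambda>h. \<rho> h $$ (i,j) * \<rho> (inv h \<otimes> g) $$ (k,l)"] by simp
    also have "\<dots> = (\<Sum>h\<in>carrier G. (\<Sum>m<n. \<rho> g $$ (i,m) * \<rho> h $$ (m,j)) * \<rho> (inv h) $$ (k,l))"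
      using ij il g by (intro sum.cong) (simp_all add: rho_mult_entry inv_mult_group m_assoc)
    also have "\<dots> = (\<Sum>m<n. \<rho> g $$ (i,m) * (\<Sum>h\<in>carrier G. \<rho> h $$ (m,j) * \<rho> (inv h) $$ (k,l)))"
      by (simp add: sum_distrib_left sum_distrib_right mult.assoc) (rule sum.swap)
    also have "\<dots> = (\<rho> g * B) $$ (i,l)"
      using il g by (simp add: B_def scalar_prod_def atLeast0LessThan)
    finally show "(B * \<rho> g) $$ (i,l) = (\<rho> g * B) $$ (i,l)" .
  qed (use B g in auto)
  then obtain c where c: "B = c \<cdot>\<^sub>m 1\<^sub>m n" using schur[OF B] by blast
  \<comment> \<open>Both sides are the trace of \<open>B\<close>; moving the factors together leaves
    \<open>\<rho> \<one>\<close> for every \<open>h\<close>.\<close>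
  have "of_nat n * c = (\<Sum>i<n. B $$ (i,i))" by (simp add: c)
  also have "\<dots> = (\<Sum>i<n. \<Sum>h\<in>carrier G. \<rho> (inv h) $$ (k,i) * \<rho> h $$ (i,j))"
    by (simp add: B_def mult.commute)
  also have "\<dots> = (\<Sum>h\<in>carrier G. \<rho> (inv h \<otimes> h) $$ (k,j))"
    using ij by (subst sum.swap) (intro sum.cong refl rho_mult_entry[symmetric]; simp)
  also have "\<dots> = (if k = j then N else 0)"
    using ij by (simp add: rho_one Coset.order_def)
  finally have "c = (if k = j then N / of_nat n else 0)"
    using n_pos by (auto simp: field_simps)
  moreover have "(\<Sum>h\<in>carrier G. \<rho> h $$ (i,j) * \<rho> (inv h) $$ (k,l)) = B $$ (i,l)"
    using ij by (simp add: B_def)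
  ultimately show ?thesis using ij by (simp add: c)
qed

text \<open>Expanding both traces into matrix coefficients leaves only the terms that orthogonality
  keeps. For \<open>a = b = \<one>\<close> this is the norm relation of an irreducible
  character.\<close>

lemma trace_convolution:
  assumes ab: "a \<in> carrier G" "b \<in> carrier G"
  shows "(\<Sum>k\<in>carrier G. mat_trace (\<rho> (a \<otimes> k)) * mat_trace (\<rho> (inv k \<otimes> b)))
    = N / of_nat n * mat_trace (\<rho> (a \<otimes> b))"
proof -
  have "(\<Sum>k\<in>carrier G. mat_trace (\<rho> (a \<otimes> k)) * mat_trace (\<rho> (inv k \<otimes> b)))
    = (\<Sum>h\<in>carrier G. \<Sum>i<n. \<Sum>k<n. \<Sum>j<n. \<Sum>l<n.
        (\<rho> a $$ (i,j) * \<rho> b $$ (l,k)) * (\<rho> h $$ (j,i) * \<rho> (inv h) $$ (k,l)))"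
    using ab by (intro sum.cong refl)
      (simp add: rho_mult mat_trace_mult[of _ n] sum_product mult_ac)
  also have "\<dots> = (\<Sum>i<n. \<Sum>k<n. \<Sum>j<n. \<Sum>l<n. (\<rho> a $$ (i,j) * \<rho> b $$ (l,k)) *
        (\<Sum>h\<in>carrier G. \<rho> h $$ (j,i) * \<rho> (inv h) $$ (k,l)))"
    by (simp add: sum_distrib_left sum.swap[of _ _ "carrier G"])
  also have "\<dots> = (\<Sum>i<n. \<Sum>k<n. if k = i then (\<Sum>j<n.
        \<rho> a $$ (i,j) * \<rho> b $$ (j,k) * (N / of_nat n)) else 0)"
    by (intro sum.cong refl) (simp add: matrix_coefficients_orthogonal if_distrib[where f = "(*) _"] cong: if_cong)
  also have "\<dots> = N / of_nat n * mat_trace (\<rho> (a \<otimes> b))"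
    using ab by (simp add: sum.delta rho_mult mat_trace_mult[of _ n] sum_distrib_left mult_ac)
  finally show ?thesis .
qed

text \<open>The class sum of \<open>g\<close> acts as the scalar
  \<open>N / of_nat n * mat_trace (\<rho> g)\<close>; its product with \<open>\<rho> k\<close> has
  the stated trace. The scalar is read off from orthogonality of coefficients.\<close>

lemma trace_class_sum:
  assumes gk: "g \<in> carrier G" "k \<in> carrier G"
  shows "(\<Sum>h\<in>carrier G. mat_trace (\<rho> (h \<otimes> g \<otimes> inv h \<otimes> k)))
    = N / of_nat n * (mat_trace (\<rho> g) * mat_trace (\<rho> k))"
proof -
  have "mat_trace (\<rho> (h \<otimes> g \<otimes> inv h \<otimes> k)) = (\<Sum>i<n. \<Sum>j<n. \<Sum>l<n. \<Sum>m<n.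
      (\<rho> g $$ (l,m) * \<rho> k $$ (j,i)) * (\<rho> h $$ (i,l) * \<rho> (inv h) $$ (m,j)))"
    if h: "h \<in> carrier G" for h
  proof -
    have "mat_trace (\<rho> (h \<otimes> g \<otimes> inv h \<otimes> k))
        = (\<Sum>i<n. \<Sum>j<n. \<rho> (h \<otimes> (g \<otimes> inv h)) $$ (i,j) * \<rho> k $$ (j,i))"
      using h gk
      by (subst rho_mult) (simp_all add: mat_trace_mult[of _ n] m_assoc del: l_inv)
    also have "\<dots> = (\<Sum>i<n. \<Sum>j<n. \<Sum>l<n. \<Sum>m<n.
      (\<rho> g $$ (l,m) * \<rho> k $$ (j,i)) * (\<rho> h $$ (i,l) * \<rho> (inv h) $$ (m,j)))"
      using h gk by (intro sum.cong refl)
        (simp add: rho_mult_entry sum_distrib_left sum_distrib_right mult_ac)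
    finally show ?thesis .
  qed
  then have "(\<Sum>h\<in>carrier G. mat_trace (\<rho> (h \<otimes> g \<otimes> inv h \<otimes> k)))
    = (\<Sum>i<n. \<Sum>j<n. \<Sum>l<n. \<Sum>m<n. (\<rho> g $$ (l,m) * \<rho> k $$ (j,i)) *
        (\<Sum>h\<in>carrier G. \<rho> h $$ (i,l) * \<rho> (inv h) $$ (m,j)))"
    by (simp add: sum_distrib_left sum.swap[of _ _ "carrier G"])
  also have "\<dots> = (\<Sum>i<n. \<Sum>j<n. if j = i then (\<Sum>l<n.
        \<rho> g $$ (l,l) * \<rho> k $$ (j,i) * (N / of_nat n)) else 0)"
    by (intro sum.cong refl) (simp add: matrix_coefficients_orthogonal if_distrib[where f = "(*) _"] cong: if_cong)
  also have "\<dots> = N / of_nat n * (mat_trace (\<rho> g) * mat_trace (\<rho> k))"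
    using gk by (simp add: sum.delta mat_trace_def sum_product sum_distrib_left mult_ac)
  finally show ?thesis .
qed

text \<open>An invariant Hermitian form makes \<open>\<rho> (inv g)\<close> similar to the adjoint
  of \<open>\<rho> g\<close>, whose trace is the complex conjugate.\<close>

lemma trace_inv:
  assumes g: "g \<in> carrier G"
  shows "mat_trace (\<rho> (inv g)) = cnj (mat_trace (\<rho> g))"
proof -
  define adj where "adj A = mat n n (\<lambda>(i,j). cnj (A $$ (j,i)))" for A
  \<comment> \<open>an invariant positive definite Hermitian form\<close>
  define H where "H = mat n n (\<lambda>(i,j). \<Sum>h\<in>carrier G. \<Sum>k<n. cnj (\<rho> h $$ (k,i)) * \<rho> h $$ (k,j))"
  have H: "H \<in> carrier_mat n n" by (simp add: H_def)
  have adj: "adj A \<in> carrier_mat n n" for A by (simp add: adj_def)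
  have inv: "H * \<rho> (inv x) = adj (\<rho> x) * H" if x: "x \<in> carrier G" for x
  proof (rule eq_matI)
    fix i j assume "i < dim_row (adj (\<rho> x) * H)" "j < dim_col (adj (\<rho> x) * H)"
    then have ij: "i < n" "j < n" by (auto simp: H_def adj_def)
    have "(H * \<rho> (inv x)) $$ (i,j) =
        (\<Sum>l<n. (\<Sum>h\<in>carrier G. \<Sum>k<n. cnj (\<rho> h $$ (k,i)) * \<rho> h $$ (k,l)) * \<rho> (inv x) $$ (l,j))"
      using ij x by (simp add: H_def scalar_prod_def atLeast0LessThan)
    also have "\<dots> = (\<Sum>l<n. \<Sum>h\<in>carrier G. \<Sum>k<n. cnj (\<rho> h $$ (k,i)) * \<rho> h $$ (k,l) * \<rho> (inv x) $$ (l,j))"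
      by (simp add: sum_distrib_right)
    also have "\<dots> = (\<Sum>h\<in>carrier G. \<Sum>l<n. \<Sum>k<n. cnj (\<rho> h $$ (k,i)) * \<rho> h $$ (k,l) * \<rho> (inv x) $$ (l,j))"
      by (rule sum.swap)
    also have "\<dots> = (\<Sum>h\<in>carrier G. \<Sum>k<n. \<Sum>l<n. cnj (\<rho> h $$ (k,i)) * \<rho> h $$ (k,l) * \<rho> (inv x) $$ (l,j))"
      by (intro sum.cong refl sum.swap)
    also have "\<dots> = (\<Sum>h\<in>carrier G. \<Sum>k<n. cnj (\<rho> h $$ (k,i)) * \<rho> (h \<otimes> inv x) $$ (k,j))"
      using ij x by (simp add: rho_mult_entry sum_distrib_left mult.assoc)
    \<comment> \<open>Substituting \<open>h \<otimes> x\<close> for \<open>h\<close> carries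
      \<open>inv x\<close> over to the conjugated factor as \<open>x\<close>.\<close>
    also have "\<dots> = (\<Sum>h\<in>carrier G. \<Sum>k<n. cnj (\<rho> (h \<otimes> x) $$ (k,i)) * \<rho> h $$ (k,j))"
      using x by (intro sum.reindex_bij_witness[of _ "\<lambda>h. h \<otimes> x" "\<lambda>h. h \<otimes> inv x"]) (auto simp: m_assoc)
    also have "\<dots> = (\<Sum>h\<in>carrier G. \<Sum>k<n. \<Sum>l<n. cnj (\<rho> x $$ (l,i)) * (cnj (\<rho> h $$ (k,l)) * \<rho> h $$ (k,j)))"
      using ij x by (intro sum.cong refl) (simp add: rho_mult_entry sum_distrib_left sum_distrib_right mult_ac)
    also have "\<dots> = (\<Sum>h\<in>carrier G. \<Sum>l<n. \<Sum>k<n. cnj (\<rho> x $$ (l,i)) * (cnj (\<rho> h $$ (k,l)) * \<rho> h $$ (k,j)))"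
      by (intro sum.cong refl sum.swap)
    also have "\<dots> = (\<Sum>l<n. \<Sum>h\<in>carrier G. \<Sum>k<n. cnj (\<rho> x $$ (l,i)) * (cnj (\<rho> h $$ (k,l)) * \<rho> h $$ (k,j)))"
      by (rule sum.swap)
    also have "\<dots> = (adj (\<rho> x) * H) $$ (i,j)"
      using ij x by (simp add: H_def adj_def scalar_prod_def atLeast0LessThan sum_distrib_left)
    finally show "(H * \<rho> (inv x)) $$ (i,j) = (adj (\<rho> x) * H) $$ (i,j)" .
  qed (use H x in \<open>auto simp: adj_def\<close>)
  have "H * \<rho> x = adj (\<rho> (inv x)) * H" if "x \<in> carrier G" for x
    using inv[of "inv x"] that by simp
  then have "mat_kernel H = {0\<^sub>v n} \<or> H = 0\<^sub>m n n"
    using adj by (intro kernel_trivial_or_zero[OF H, of "\<lambda>x. adj (\<rho> (inv x))"]) auto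
  \<comment> \<open>The corner entry of \<open>H\<close> is a sum of squared moduli, and
    \<open>h = \<one>\<close> contributes a positive term. Invertibility then follows from the
    kernel alternative.\<close>
  moreover have "H \<noteq> 0\<^sub>m n n"
  proof
    assume "H = 0\<^sub>m n n"
    then have "H $$ (0,0) = 0" using n_pos by simp
    then have "(\<Sum>h\<in>carrier G. \<Sum>k<n. (cmod (\<rho> h $$ (k,0)))\<^sup>2) = 0"
      using n_pos by (simp add: H_def complex_norm_square[symmetric] mult.commute[of "cnj _"]
          of_real_sum[symmetric] del: of_real_sum of_real_power)
    then have "\<rho> \<one> $$ (0,0) = 0"
      using fin n_pos by (subst (asm) sum_nonneg_eq_0_iff; (intro sum_nonneg)?; simp add: sum_nonneg_eq_0_iff)
    then show False using n_pos by (simp add: rho_one)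
  qed
  ultimately have "det H \<noteq> 0"
    using det_0_iff_vec_prod_zero[OF H] mat_kernelI[OF H] by blast
  from det_non_zero_imp_unit[OF H this, of "()"]
  obtain H' where H': "H' \<in> carrier_mat n n" "H' * H = 1\<^sub>m n" "H * H' = 1\<^sub>m n"
    by (auto simp: Units_def ring_mat_simps)
  have "mat_trace (\<rho> (inv g)) = mat_trace ((H' * H) * \<rho> (inv g))"
    using g H' by simp
  also have "\<dots> = mat_trace (H' * (adj (\<rho> g) * H))"
    using g H' H inv[OF g] by (subst assoc_mult_mat[of _ n n _ n _ n]) simp_all
  also have "\<dots> = mat_trace (adj (\<rho> g) * H * H')"
    using H H'(1) adj by (intro mat_trace_comm[of _ n] mult_carrier_mat[of _ n n]) auto
  also have "\<dots> = mat_trace (adj (\<rho> g))"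
    using g H' H adj[of "\<rho> g"] by (simp add: assoc_mult_mat[of _ n n _ n _ n])
  also have "\<dots> = cnj (mat_trace (\<rho> g))"
    using g by (simp add: mat_trace_def adj_def)
  finally show ?thesis .
qed

end

section \<open>Irreducible characters and homogeneous products\<close>

locale irr_char = group G for G (structure) +
  fixes \<chi> :: "'a \<Rightarrow> complex"
  assumes fin: "finite (carrier G)"
    and Irr: "\<chi> \<in> Irr G"
begin

abbreviation "ordG \<equiv> of_nat (Coset.order G) :: complex"

lemma ordG_nonzero: "ordG \<noteq> 0"
  using fin one_closed by (auto simp: Coset.order_def)

lemma affording_rep:
  obtains n \<rho> where "irreducible_rep G n \<rho>" "\<And>g. g \<in> carrier G \<Longrightarrow> \<chi> g = mat_trace (\<rho> g)"
    "\<chi> \<one> = of_nat n"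
proof -
  obtain n \<rho> where *: "irreducible_representation G n \<rho>" "\<chi> = (\<lambda>g\<in>carrier G. mat_trace (\<rho> g))"
    using Irr unfolding Irr_def by blast
  interpret irreducible_rep G n \<rho> by unfold_locales (use * fin in auto)
  show thesis
    by (rule that[of n \<rho>]) (simp_all add: * irreducible_rep_axioms rho_one mat_trace_def)
qed

lemma degree_pos: obtains n where "\<chi> \<one> = of_nat n" "n > 0"
  using affording_rep irreducible_rep.n_pos by metis

lemma degree_nonzero [simp]: "\<chi> \<one> \<noteq> 0"
  using degree_pos by (metis of_nat_eq_0_iff less_irrefl)

lemma char_comm:
  assumes ab: "a \<in> carrier G" "b \<in> carrier G"
  shows "\<chi> (a \<otimes> b) = \<chi> (b \<otimes> a)"
proof -
  obtain n \<rho> where \<rho>: "irreducible_rep G n \<rho>" "\<And>g. g \<in> carrier G \<Longrightarrow> \<chi> g = mat_trace (\<rho> g)"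
    using affording_rep by metis
  interpret irreducible_rep G n \<rho> by fact
  show ?thesis using ab by (simp add: \<rho>(2) rho_mult mat_trace_comm[of _ n])
qed

lemma char_inv: "a \<in> carrier G \<Longrightarrow> \<chi> (inv a) = cnj (\<chi> a)"
  using affording_rep irreducible_rep.trace_inv inv_closed by metis

lemma char_class_sum:
  assumes "g \<in> carrier G" "k \<in> carrier G"
  shows "(\<Sum>h\<in>carrier G. \<chi> (h \<otimes> g \<otimes> inv h \<otimes> k)) = ordG / \<chi> \<one> * (\<chi> g * \<chi> k)"
proof -
  obtain n \<rho> where \<rho>: "irreducible_rep G n \<rho>" "\<And>g. g \<in> carrier G \<Longrightarrow> \<chi> g = mat_trace (\<rho> g)"
     "\<chi> \<one> = of_nat n" using affording_rep by metis
  show ?thesis using irreducible_rep.trace_class_sum[OF \<rho>(1) assms] assms by (simp add: \<rho>(2,3))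
qed

lemma char_convolution:
  assumes "a \<in> carrier G" "b \<in> carrier G"
  shows "(\<Sum>k\<in>carrier G. \<chi> (a \<otimes> k) * \<chi> (inv k \<otimes> b)) = ordG / \<chi> \<one> * \<chi> (a \<otimes> b)"
proof -
  obtain n \<rho> where \<rho>: "irreducible_rep G n \<rho>" "\<And>g. g \<in> carrier G \<Longrightarrow> \<chi> g = mat_trace (\<rho> g)"
     "\<chi> \<one> = of_nat n" using affording_rep by metis
  show ?thesis using irreducible_rep.trace_convolution[OF \<rho>(1) assms] assms by (simp add: \<rho>(2,3))
qed

lemma char_convolution':
  assumes "a \<in> carrier G" "b \<in> carrier G"
  shows "(\<Sum>k\<in>carrier G. \<chi> (a \<otimes> inv k) * \<chi> (k \<otimes> b)) = ordG / \<chi> \<one> * \<chi> (a \<otimes> b)"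
  unfolding char_convolution[OF assms, symmetric]
  by (rule sum.reindex_bij_witness[of _ "\<lambda>k. inv k" "\<lambda>k. inv k"]) auto

lemma char_conj:
  assumes "g \<in> carrier G" "h \<in> carrier G"
  shows "\<chi> (h \<otimes> g \<otimes> inv h) = \<chi> g"
  using char_comm[of "h \<otimes> g" "inv h"] assms by (simp add: m_assoc[symmetric])

section \<open>Restriction of an irreducible character to the centre\<close>

lemma group_center_closed: "z \<in> group_center G \<Longrightarrow> z \<in> carrier G"
  by (simp add: group_center_def)

text \<open>All conjugates of \<open>z\<close> coincide, so every term of the class sum equals
  \<open>\<chi> (z \<otimes> g)\<close>.\<close>

lemma char_central_mult:
  assumes z: "z \<in> group_center G" and g: "g \<in> carrier G"
  shows "\<chi> (z \<otimes> g) = \<chi> z / \<chi> \<one> * \<chi> g"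
proof -
  have "h \<otimes> z \<otimes> inv h \<otimes> g = z \<otimes> g" if h: "h \<in> carrier G" for h
  proof -
    have "h \<otimes> z = z \<otimes> h" "z \<in> carrier G" using z h by (auto simp: group_center_def)
    then have "h \<otimes> z \<otimes> inv h = z" using h by (simp add: m_assoc)
    then show ?thesis by simp
  qed
  then have "ordG * \<chi> (z \<otimes> g) = ordG / \<chi> \<one> * (\<chi> z * \<chi> g)"
    using char_class_sum[of z g] z g by (simp add: group_center_def Coset.order_def)
  then show ?thesis using ordG_nonzero by (simp add: field_simps)
qed

text \<open>On the centre this is the linear character below \<open>\<chi>\<close>: the scalar by
  which a central element acts. It is the \<open>\<lambda>\<close> or \<open>\<mu>\<close> of the
  overview.\<close>

definition central_char :: "'a \<Rightarrow> complex" where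
  "central_char z = \<chi> z / \<chi> \<one>"

lemma central_char_eq: 
  "z \<in> group_center G \<Longrightarrow> g \<in> carrier G \<Longrightarrow> \<chi> (z \<otimes> g) = central_char z * \<chi> g"
  by (simp add: char_central_mult central_char_def)

lemma central_char_eq': 
  "z \<in> group_center G \<Longrightarrow> g \<in> carrier G \<Longrightarrow> \<chi> (g \<otimes> z) = central_char z * \<chi> g"
  using char_comm[of g z] by (simp add: central_char_eq group_center_closed)

lemma central_char_one: "central_char \<one> = 1"
  by (simp add: central_char_def)

lemma central_char_mult:
  "z \<in> group_center G \<Longrightarrow> y \<in> carrier G \<Longrightarrow> central_char (z \<otimes> y) = central_char z * central_char y"
  by (simp add: central_char_eq central_char_def)

lemma central_char_pow:
  "z \<in> group_center G \<Longrightarrow> central_char (z [^] (k::nat)) = central_char z ^ k"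
proof (induction k)
  case (Suc k)
  then show ?case
    using central_char_mult[of z "z [^] k"] nat_pow_Suc2[of z k] by (simp add: group_center_closed)
qed (simp add: central_char_one)

lemma central_char_injective:
  assumes "faithful_char G \<chi>" "z \<in> group_center G" "central_char z = 1"
  shows "z = \<one>"
  using assms by (auto simp: faithful_char_def char_kernel_def central_char_def group_center_def)

lemma center_pow_card:
  assumes "z \<in> group_center G"
  shows "z [^] card (group_center G) = \<one>"
proof -
  interpret Z: group "G\<lparr>carrier := group_center G\<rparr>"
    by (rule subgroup.subgroup_is_group[OF subgroup_center is_group])
  have "z [^]\<^bsub>G\<lparr>carrier := group_center G\<rparr>\<^esub> card (group_center G) = \<one>"
    using Z.pow_order_eq_1[of z] assms by (simp add: Coset.order_def)
  then show ?thesis by (simp add: nat_pow_consistent[symmetric])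
qed

lemma finite_center: "finite (group_center G)"
  using fin by (rule rev_finite_subset) (auto simp: group_center_def)

lemma card_center_pos: "card (group_center G) > 0"
  using finite_center subgroup.one_closed[OF subgroup_center] by (auto simp: card_gt_0_iff)

lemma central_char_eq_imp_eq:
  assumes "faithful_char G \<chi>" "x \<in> group_center G" "y \<in> group_center G"
    and eq: "central_char x = central_char y"
  shows "x = y"
proof -
  have y: "inv y \<in> group_center G" using assms by (intro subgroup.m_inv_closed[OF subgroup_center])
  have cl: "x \<in> carrier G" "y \<in> carrier G" using assms by (auto intro: group_center_closed)
  have "central_char (inv y \<otimes> x) = central_char (inv y \<otimes> y)"
    using y cl by (simp only: central_char_mult eq)
  then have "central_char (inv y \<otimes> x) = 1" using cl by (simp add: central_char_one)
  moreover have "inv y \<otimes> x \<in> group_center G"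
    using y assms by (intro subgroup.m_closed[OF subgroup_center])
  ultimately have "inv y \<otimes> x = \<one>" using central_char_injective assms(1) by blast
  then show ?thesis using cl mult_inv_cancel(2)[of y x] by simp
qed

text \<open>Faithfulness makes the map injective, its values are roots of unity of order dividing
  \<open>card (group_center G)\<close>, and there are exactly that many of these, so counting gives
  equality.\<close>

lemma central_char_image:
  assumes "faithful_char G \<chi>"
  shows "central_char ` group_center G = {w. w ^ card (group_center G) = 1}"
proof (rule card_subset_eq)
  show "finite {w::complex. w ^ card (group_center G) = 1}"
    using card_center_pos by (intro finite_roots_unity) simp
  show "central_char ` group_center G \<subseteq> {w. w ^ card (group_center G) = 1}"
    by (auto simp: central_char_pow[symmetric] center_pow_card central_char_one)
  have "inj_on central_char (group_center G)"
    using central_char_eq_imp_eq[OF assms] by (auto intro: inj_onI)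
  then show "card (central_char ` group_center G) = card {w::complex. w ^ card (group_center G) = 1}"
    using card_center_pos by (simp add: card_image card_roots_unity_eq)
qed

text \<open>In the norm relation only central elements contribute, each
  \<open>(\<chi> \<one>)\<^sup>2\<close>; Lagrange's theorem turns this into the index.\<close>

lemma fully_ramified_if_vanishing_off_center:
  assumes "\<And>g. g \<in> carrier G - group_center G \<Longrightarrow> \<chi> g = 0"
  shows "fully_ramified G \<chi>"
proof -
  have "ordG = (\<Sum>k\<in>carrier G. \<chi> k * \<chi> (inv k))"
    using char_convolution[of \<one> \<one>] by simp
  also have "\<dots> = (\<Sum>k\<in>group_center G. \<chi> k * \<chi> (inv k))"
    using fin assms by (intro sum.mono_neutral_right) (auto simp: group_center_def)
  also have "\<dots> = (\<Sum>k\<in>group_center G. (\<chi> \<one>)\<^sup>2)"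
  proof (rule sum.cong[OF refl])
    fix z assume z: "z \<in> group_center G"
    then have "\<chi> (z \<otimes> inv z) = \<chi> z / \<chi> \<one> * \<chi> (inv z)"
      by (intro char_central_mult) (auto simp: group_center_def)
    then show "\<chi> z * \<chi> (inv z) = (\<chi> \<one>)\<^sup>2"
      using z group_center_closed by (simp add: field_simps power2_eq_square)
  qed
  finally have "of_nat (Coset.order G) = of_nat (card (group_center G)) * (\<chi> \<one>)\<^sup>2" by simp
  moreover have "Coset.order G = card (rcosets group_center G) * card (group_center G)"
    using lagrange[OF subgroup_center] by simp
  ultimately show ?thesis
    using card_center_pos by (simp add: fully_ramified_def)
qed

end

locale irr_product =
  \<psi>: irr_char G \<psi> + \<phi>: irr_char G \<phi> + \<chi>: irr_char G \<chi> for G (structure) and \<psi> \<phi> \<chi> +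
  fixes m :: nat
  assumes m_pos: "m > 0"
    and product: "\<And>g. g \<in> carrier G \<Longrightarrow> \<psi> g * \<phi> g = of_nat m * \<chi> g"
begin

lemma char_nonzero_iff: "g \<in> carrier G \<Longrightarrow> \<chi> g \<noteq> 0 \<longleftrightarrow> \<psi> g \<noteq> 0 \<and> \<phi> g \<noteq> 0"
  using product[of g] m_pos by (metis mult_eq_0_iff of_nat_eq_0_iff less_irrefl)

text \<open>The sum over \<open>a\<close>, \<open>b\<close> of the squared moduli of the left-hand sides is, by convolution, a multiple
  of \<open>\<Sum>\<^sub>i\<^sub>j w\<^sub>i cnj w\<^sub>j \<psi>\<phi>(x\<^sub>j\<^sup>-\<^sup>1 x\<^sub>i)\<close>, which the relation for \<open>\<chi>\<close> annihilates. This replaces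
  any decomposition of the tensor product.\<close>

lemma relation_transfer:
  assumes I: "finite I" and x: "\<And>i. i \<in> I \<Longrightarrow> x i \<in> carrier G"
    and rel: "\<And>k. k \<in> carrier G \<Longrightarrow> (\<Sum>i\<in>I. w i * \<chi> (k \<otimes> x i)) = 0"
    and ab: "a \<in> carrier G" "b \<in> carrier G"
  shows "(\<Sum>i\<in>I. w i * (\<psi> (a \<otimes> x i) * \<phi> (b \<otimes> x i))) = 0"
proof -
  define F where "F a b = (\<Sum>i\<in>I. w i * (\<psi> (a \<otimes> x i) * \<phi> (b \<otimes> x i)))" for a b
  define c where "c = \<psi>.ordG / \<psi> \<one> * (\<psi>.ordG / \<phi> \<one>)"
  have "(\<Sum>a\<in>carrier G. \<Sum>b\<in>carrier G. F a b * cnj (F a b)) =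
    (\<Sum>a\<in>carrier G. \<Sum>b\<in>carrier G. \<Sum>j\<in>I. \<Sum>i\<in>I. w i * cnj (w j) *
       ((\<psi> (inv (x j) \<otimes> inv a) * \<psi> (a \<otimes> x i)) * (\<phi> (inv (x j) \<otimes> inv b) * \<phi> (b \<otimes> x i))))"
  proof (intro sum.cong refl)
    fix a b assume ab: "a \<in> carrier G" "b \<in> carrier G"
    have "cnj (F a b) = (\<Sum>j\<in>I. cnj (w j) * (\<psi> (inv (x j) \<otimes> inv a) * \<phi> (inv (x j) \<otimes> inv b)))"
      unfolding F_def using ab x
      by (simp add: \<psi>.char_inv[symmetric] \<phi>.char_inv[symmetric] \<psi>.inv_mult_group)
    then show "F a b * cnj (F a b) = (\<Sum>j\<in>I. \<Sum>i\<in>I. w i * cnj (w j) *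
       ((\<psi> (inv (x j) \<otimes> inv a) * \<psi> (a \<otimes> x i)) * (\<phi> (inv (x j) \<otimes> inv b) * \<phi> (b \<otimes> x i))))"
      by (subst sum.swap) (simp add: F_def sum_product mult_ac)
  qed
  also have "\<dots> = (\<Sum>(j,i)\<in>I \<times> I. \<Sum>a\<in>carrier G. \<Sum>b\<in>carrier G. w i * cnj (w j) *
       ((\<psi> (inv (x j) \<otimes> inv a) * \<psi> (a \<otimes> x i)) * (\<phi> (inv (x j) \<otimes> inv b) * \<phi> (b \<otimes> x i))))"
    by (simp add: sum.cartesian_product[of _ I I] case_prod_unfold sum.swap[of _ _ "I \<times> I"])
  also have "\<dots> = (\<Sum>j\<in>I. \<Sum>i\<in>I. w i * cnj (w j) *
     ((\<Sum>a\<in>carrier G. \<psi> (inv (x j) \<otimes> inv a) * \<psi> (a \<otimes> x i)) *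
      (\<Sum>b\<in>carrier G. \<phi> (inv (x j) \<otimes> inv b) * \<phi> (b \<otimes> x i))))"
    by (simp only: sum.cartesian_product[symmetric] sum_product) (simp only: sum_distrib_left)
  also have "\<dots> = (\<Sum>j\<in>I. \<Sum>i\<in>I. w i * cnj (w j) * (c * (of_nat m * \<chi> (inv (x j) \<otimes> x i))))"
    using x by (intro sum.cong refl)
      (simp add: \<psi>.char_convolution' \<phi>.char_convolution' product[symmetric] c_def)
  \<comment> \<open>For each \<open>j\<close> the inner sum is the hypothesis \<open>rel\<close> at
    \<open>k = inv (x j)\<close>.\<close>
  also have "\<dots> = (\<Sum>j\<in>I. cnj (w j) * c * of_nat m * (\<Sum>i\<in>I. w i * \<chi> (inv (x j) \<otimes> x i)))"
    by (simp add: sum_distrib_left mult_ac)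
  also have "\<dots> = 0" using rel x by simp
  finally have "complex_of_real (\<Sum>a\<in>carrier G. \<Sum>b\<in>carrier G. (cmod (F a b))\<^sup>2) = 0"
    by (simp add: complex_norm_square del: of_real_power)
  then have "(\<Sum>a\<in>carrier G. \<Sum>b\<in>carrier G. (cmod (F a b))\<^sup>2) = 0"
    by (simp only: of_real_eq_0_iff)
  then have "(cmod (F a b))\<^sup>2 = 0"
    using ab \<psi>.fin by (simp add: sum_nonneg_eq_0_iff sum_nonneg)
  then show ?thesis by (simp add: F_def)
qed

text \<open>The relation that the class sum of \<open>g\<close> equals a scalar holds for
  \<open>\<chi>\<close>, and \<open>relation_transfer\<close> carries it to the two factors. The
  translations \<open>a\<close> and \<open>b\<close> are independent, which is more than multiplying
  the characters would give.\<close>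

lemma class_sum_transfer:
  assumes g: "g \<in> carrier G" and ab: "a \<in> carrier G" "b \<in> carrier G"
  shows "(\<Sum>h\<in>carrier G. \<psi> (h \<otimes> g \<otimes> inv h \<otimes> a) * \<phi> (h \<otimes> g \<otimes> inv h \<otimes> b)) =
    \<psi>.ordG * (\<chi> g / \<chi> \<one>) * (\<psi> a * \<phi> b)"
proof -
  \<comment> \<open>The relation is indexed by \<open>G\<close> together with one extra index, which
    holds \<open>\<one>\<close> with minus the scalar as its weight.\<close>
  define x where "x = case_sum (\<lambda>h. h \<otimes> g \<otimes> inv h) (\<lambda>_::unit. \<one>)"
  define w where "w = case_sum (\<lambda>h::'a. 1) (\<lambda>_::unit. - (\<psi>.ordG * (\<chi> g / \<chi> \<one>)))"
  have "(\<Sum>i\<in>carrier G <+> UNIV. w i * (\<psi> (a \<otimes> x i) * \<phi> (b \<otimes> x i))) = 0"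
  proof (rule relation_transfer)
    fix k assume k: "k \<in> carrier G"
    have "(\<Sum>h\<in>carrier G. \<chi> (k \<otimes> (h \<otimes> g \<otimes> inv h))) = (\<Sum>h\<in>carrier G. \<chi> (h \<otimes> g \<otimes> inv h \<otimes> k))"
      using g k by (intro sum.cong refl \<chi>.char_comm) auto
    then show "(\<Sum>i\<in>carrier G <+> UNIV. w i * \<chi> (k \<otimes> x i)) = 0"
      using \<psi>.fin g k by (simp add: sum.Plus w_def x_def \<chi>.char_class_sum)
  qed (use \<psi>.fin g ab in \<open>auto simp: x_def\<close>)
  then have "(\<Sum>h\<in>carrier G. \<psi> (a \<otimes> (h \<otimes> g \<otimes> inv h)) * \<phi> (b \<otimes> (h \<otimes> g \<otimes> inv h))) =
      \<psi>.ordG * (\<chi> g / \<chi> \<one>) * (\<psi> a * \<phi> b)"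
    using \<psi>.fin ab by (simp add: sum.Plus w_def x_def)
  moreover have "(\<Sum>h\<in>carrier G. \<psi> (h \<otimes> g \<otimes> inv h \<otimes> a) * \<phi> (h \<otimes> g \<otimes> inv h \<otimes> b)) =
      (\<Sum>h\<in>carrier G. \<psi> (a \<otimes> (h \<otimes> g \<otimes> inv h)) * \<phi> (b \<otimes> (h \<otimes> g \<otimes> inv h)))"
    using g ab by (intro sum.cong refl arg_cong2[where f = "(*)"] \<psi>.char_comm \<phi>.char_comm) auto
  ultimately show ?thesis by simp
qed

text \<open>Sum \<open>class_sum_transfer\<close> with \<open>a = y\<close> and
  \<open>b = y [^] k\<close> over \<open>Y\<close>. Conjugation of \<open>g\<close> can be traded
  for conjugation of \<open>y\<close>, which only permutes \<open>Y\<close>, so the average over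
  \<open>h\<close> is trivial.\<close>

lemma sum_over_invariant_set:
  assumes g: "g \<in> carrier G" and Y: "Y \<subseteq> carrier G"
    and inv: "\<And>h y. h \<in> carrier G \<Longrightarrow> y \<in> Y \<Longrightarrow> h \<otimes> y \<otimes> inv h \<in> Y"
  shows "(\<Sum>y\<in>Y. \<psi> (g \<otimes> y) * \<phi> (g \<otimes> y [^] (k::nat))) =
    \<chi> g / \<chi> \<one> * (\<Sum>y\<in>Y. \<psi> y * \<phi> (y [^] k))"
proof -
  have move: "\<theta> (h \<otimes> g \<otimes> inv h \<otimes> y) = \<theta> (g \<otimes> (inv h \<otimes> y \<otimes> h))"
    if "irr_char G \<theta>" "h \<in> carrier G" "y \<in> carrier G" for \<theta> h y
    using irr_char.char_comm[OF that(1), of h "g \<otimes> inv h \<otimes> y"] that(2,3) g by (simp add: \<psi>.m_assoc)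
  have "\<psi>.ordG * (\<chi> g / \<chi> \<one> * (\<Sum>y\<in>Y. \<psi> y * \<phi> (y [^] k))) =
    (\<Sum>y\<in>Y. \<Sum>h\<in>carrier G. \<psi> (h \<otimes> g \<otimes> inv h \<otimes> y) * \<phi> (h \<otimes> g \<otimes> inv h \<otimes> y [^] k))"
    unfolding sum_distrib_left using g Y by (intro sum.cong refl) (subst class_sum_transfer, auto)
  also have "\<dots> = (\<Sum>h\<in>carrier G. \<Sum>y\<in>Y. \<psi> (h \<otimes> g \<otimes> inv h \<otimes> y) * \<phi> (h \<otimes> g \<otimes> inv h \<otimes> y [^] k))"
    by (rule sum.swap)
  also have "\<dots> = (\<Sum>h\<in>carrier G. \<Sum>y\<in>Y. \<psi> (g \<otimes> y) * \<phi> (g \<otimes> y [^] k))"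
  proof (rule sum.cong[OF refl])
    fix h assume h: "h \<in> carrier G"
    have "(\<Sum>y\<in>Y. \<psi> (h \<otimes> g \<otimes> inv h \<otimes> y) * \<phi> (h \<otimes> g \<otimes> inv h \<otimes> y [^] k)) =
      (\<Sum>y\<in>Y. \<psi> (g \<otimes> (inv h \<otimes> y \<otimes> h)) * \<phi> (g \<otimes> (inv h \<otimes> y \<otimes> h) [^] k))"
      using h Y \<psi>.conj_nat_pow[of "inv h"] 
      by (intro sum.cong refl) (simp add: subset_iff move[OF \<psi>.irr_char_axioms] move[OF \<phi>.irr_char_axioms])
    also have "\<dots> = (\<Sum>y\<in>Y. \<psi> (g \<otimes> y) * \<phi> (g \<otimes> y [^] k))"
      using h Y inv[of h] inv[of "inv h"]
      by (intro sum.reindex_bij_witness[of _ "\<lambda>y. h \<otimes> y \<otimes> inv h" "\<lambda>y. inv h \<otimes> y \<otimes> h"])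
        (auto simp: subset_iff \<psi>.m_assoc \<psi>.mult_inv_cancel)
    finally show "(\<Sum>y\<in>Y. \<psi> (h \<otimes> g \<otimes> inv h \<otimes> y) * \<phi> (h \<otimes> g \<otimes> inv h \<otimes> y [^] k)) =
      (\<Sum>y\<in>Y. \<psi> (g \<otimes> y) * \<phi> (g \<otimes> y [^] k))" .
  qed
  also have "\<dots> = \<psi>.ordG * (\<Sum>y\<in>Y. \<psi> (g \<otimes> y) * \<phi> (g \<otimes> y [^] k))"
    by (simp add: Coset.order_def)
  finally show ?thesis using \<psi>.ordG_nonzero by (simp only: mult_cancel_left) simp
qed

end

section \<open>Faithful factors in a p-group\<close>

locale faithful_irr_product = irr_product +
  assumes faithful: "faithful_char G \<psi>" "faithful_char G \<phi>"
begin

abbreviation "Z \<equiv> group_center G"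

text \<open>Both central characters take values in the same group of roots of unity. An element
  \<open>z0\<close> on which that of \<open>\<phi>\<close> takes a primitive value generates the
  centre, so it suffices to choose \<open>k\<close> for \<open>z0\<close>.\<close>

lemma complementary_exponent:
  obtains k :: nat where "\<And>z. z \<in> Z \<Longrightarrow> \<psi>.central_char z * \<phi>.central_char z ^ k = 1"
proof -
  define M where "M = card Z"
  have M: "M > 0" unfolding M_def by (rule \<psi>.card_center_pos)
  \<comment> \<open>A primitive root of unity of order \<open>M\<close>.\<close>
  define w where "w = cis (2 * pi / real M)"
  have roots: "\<exists>i. x = w ^ i" if "x ^ M = 1" for x
  proof -
    have "x \<in> (\<lambda>k. cis (2 * pi * real k / real M)) ` {..<M}"
      using Complex.bij_betw_roots_unity[OF M] that by (simp add: bij_betw_def)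
    then obtain i where "x = cis (2 * pi * real i / real M)" by blast
    then have "x = w ^ i" by (simp add: w_def DeMoivre mult_ac)
    then show ?thesis by blast
  qed
  have "w ^ M = 1" using M by (simp add: w_def DeMoivre)
  then obtain z0 where z0: "z0 \<in> Z" "\<phi>.central_char z0 = w"
    using \<phi>.central_char_image[OF faithful(2)] by (metis (mono_tags) M_def imageE mem_Collect_eq)
  have \<psi>z0: "\<psi>.central_char z0 ^ M = 1"
    using \<psi>.central_char_image[OF faithful(1)] z0(1) by (auto simp: M_def)
  then have nz: "\<psi>.central_char z0 \<noteq> 0" using M by (auto simp: power_0_left)
  have "(inverse (\<psi>.central_char z0)) ^ M = 1"
    using \<psi>z0 by (simp add: power_inverse)
  then obtain k where k: "inverse (\<psi>.central_char z0) = w ^ k" using roots by blast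
  show thesis
  proof (rule that[of k])
    fix z assume z: "z \<in> Z"
    then have "\<phi>.central_char z ^ M = 1"
      using \<phi>.central_char_image[OF faithful(2)] by (auto simp: M_def)
    then obtain i where "\<phi>.central_char z = w ^ i" using roots by blast
    \<comment> \<open>Injectivity of the central character of \<open>\<phi>\<close> now shows that
      \<open>z\<close> is a power of \<open>z0\<close>.\<close>
    then have "\<phi>.central_char z = \<phi>.central_char (z0 [^] i)"
      using z0 by (simp add: \<phi>.central_char_pow)
    moreover have "z0 [^] i \<in> Z"
      using z0(1) by (rule \<psi>.center_nat_pow_closed)
    ultimately have zi: "z = z0 [^] i" using \<phi>.central_char_eq_imp_eq[OF faithful(2) z] by blast
    have "\<psi>.central_char z * \<phi>.central_char z ^ k = (\<psi>.central_char z0 * w ^ k) ^ i"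
      using z0 by (simp add: zi \<psi>.central_char_pow \<phi>.central_char_pow power_mult_distrib power_mult[symmetric] mult.commute)
    also have "\<dots> = 1" using nz k by (metis power_one right_inverse)
    finally show "\<psi>.central_char z * \<phi>.central_char z ^ k = 1" .
  qed
qed

text \<open>The property carried up the central series. It is vacuous for \<open>E = Z\<close>,
  where the ascent starts.\<close>

definition sparse_on :: "'a set \<Rightarrow> bool" where
  "sparse_on E \<longleftrightarrow> (\<forall>g\<in>carrier G. \<forall>b\<in>E - Z. \<chi> g \<noteq> 0 \<longrightarrow> \<psi> (g \<otimes> b) = 0 \<and> \<phi> (g \<otimes> b) = 0)"

text \<open>If \<open>\<chi> x\<close> is nonzero, a commutator \<open>e\<close> of \<open>x\<close>
  lies in \<open>E\<close> and satisfies \<open>\<psi> (e \<otimes> x) = \<psi> x\<close>, which is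
  nonzero. Sparseness puts \<open>e\<close> in \<open>Z\<close>, where it acts by the scalar
  \<open>1\<close>, so faithfulness gives \<open>e = \<one>\<close> and \<open>x\<close> is
  central.\<close>

lemma vanish_on_relative_center:
  assumes E: "E \<lhd> G" and sparse: "sparse_on E"
    and x: "x \<in> \<psi>.relative_center E" "x \<notin> Z"
  shows "\<chi> x = 0"
proof (rule ccontr)
  assume nz: "\<chi> x \<noteq> 0"
  have xG: "x \<in> carrier G" using x by (simp add: \<psi>.relative_center_def)
  then have \<psi>x: "\<psi> x \<noteq> 0" using nz char_nonzero_iff by simp
  have "h \<otimes> x = x \<otimes> h" if h: "h \<in> carrier G" for h
  proof -
    define e where "e = h \<otimes> x \<otimes> inv h \<otimes> inv x"
    have eE: "e \<in> E" using x h by (simp add: \<psi>.relative_center_def e_def)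
    have eG: "e \<in> carrier G" using h xG by (simp add: e_def)
    have "h \<otimes> x \<otimes> inv h = e \<otimes> x" using h xG by (simp add: e_def \<psi>.m_assoc)
    then have \<psi>e: "\<psi> (e \<otimes> x) = \<psi> x" using \<psi>.char_conj[OF xG h] by simp
    then have "\<psi> (x \<otimes> e) \<noteq> 0" using \<psi>.char_comm[OF xG eG] \<psi>x by simp
    then have eZ: "e \<in> Z" using sparse eE xG nz by (auto simp: sparse_on_def)
    then have "\<psi>.central_char e = 1" using \<psi>e \<psi>.central_char_eq[OF eZ xG] \<psi>x by simp
    then have "e = \<one>" using \<psi>.central_char_injective[OF faithful(1) eZ] by simp
    then have "h \<otimes> x \<otimes> inv h = x" using \<open>h \<otimes> x \<otimes> inv h = e \<otimes> x\<close> xG by simp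
    then show ?thesis using h xG \<psi>.inv_solve_right' by (metis \<psi>.m_closed)
  qed
  then have "x \<in> Z" using xG by (simp add: group_center_def)
  then show False using x by simp
qed

text \<open>Centrality of the coset of \<open>b\<close> in \<open>G Mod E\<close> makes it
  conjugation-invariant, so \<open>sum_over_invariant_set\<close> applies. On the left
  \<open>zero\<close> leaves only \<open>e \<in> Z\<close>, and the choice of \<open>k\<close> makes
  those terms equal.\<close>

lemma coset_sum:
  assumes k: "\<And>z. z \<in> Z \<Longrightarrow> \<psi>.central_char z * \<phi>.central_char z ^ k = 1"
    and E: "E \<lhd> G" "Z \<subseteq> E" and gb: "g \<in> carrier G" "b \<in> carrier G"
    and b: "b \<in> \<psi>.relative_center E"
    and zero: "\<And>e. e \<in> E - Z \<Longrightarrow> \<psi> (g \<otimes> (b \<otimes> e)) * \<phi> (g \<otimes> (b \<otimes> e) [^] k) = 0"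
  shows "of_nat (card Z) * (\<psi> (g \<otimes> b) * \<phi> (g \<otimes> b [^] k)) =
    \<chi> g / \<chi> \<one> * (\<Sum>e\<in>E. \<psi> (b \<otimes> e) * \<phi> ((b \<otimes> e) [^] k))"
proof -
  interpret E: normal E G by fact
  have finE: "finite E" using E.subset \<psi>.fin finite_subset by blast
  define Y where "Y = (\<lambda>e. b \<otimes> e) ` E"
  have inj: "inj_on (\<lambda>e. b \<otimes> e) E" 
    by (rule inj_onI) (use gb in simp)
  have "(\<Sum>y\<in>Y. \<psi> (g \<otimes> y) * \<phi> (g \<otimes> y [^] k)) = \<chi> g / \<chi> \<one> * (\<Sum>y\<in>Y. \<psi> y * \<phi> (y [^] k))"
  proof (rule sum_over_invariant_set)
    fix h y assume h: "h \<in> carrier G" and "y \<in> Y"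
    then obtain e where e: "e \<in> E" "y = b \<otimes> e" by (auto simp: Y_def)
    have eG: "e \<in> carrier G" using e E.subset by blast
    define c where "c = h \<otimes> b \<otimes> inv h \<otimes> inv b"
    have c: "c \<in> E" using b h by (simp add: \<psi>.relative_center_def c_def)
    have "inv b \<otimes> c \<otimes> b \<otimes> (h \<otimes> e \<otimes> inv h) \<in> E"
      using E.inv_op_closed2[of h e] E.inv_op_closed1[of b c] h e c gb by simp
    \<comment> \<open>Conjugating \<open>b\<close> yields \<open>c \<otimes> b\<close>; normality
      lets \<open>c\<close> pass to the right of \<open>b\<close>.\<close>
    moreover have "h \<otimes> y \<otimes> inv h = b \<otimes> (inv b \<otimes> c \<otimes> b \<otimes> (h \<otimes> e \<otimes> inv h))"
      using h gb eG by (simp add: e(2) c_def \<psi>.m_assoc \<psi>.mult_inv_cancel)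
    ultimately show "h \<otimes> y \<otimes> inv h \<in> Y" by (simp add: Y_def)
  qed (use gb E.subset in \<open>auto simp: Y_def\<close>)
  then have "(\<Sum>e\<in>E. \<psi> (g \<otimes> (b \<otimes> e)) * \<phi> (g \<otimes> (b \<otimes> e) [^] k)) =
      \<chi> g / \<chi> \<one> * (\<Sum>e\<in>E. \<psi> (b \<otimes> e) * \<phi> ((b \<otimes> e) [^] k))"
    unfolding Y_def by (simp add: sum.reindex[OF inj] o_def)
  moreover have "(\<Sum>e\<in>E. \<psi> (g \<otimes> (b \<otimes> e)) * \<phi> (g \<otimes> (b \<otimes> e) [^] k)) =
      (\<Sum>z\<in>Z. \<psi> (g \<otimes> (b \<otimes> z)) * \<phi> (g \<otimes> (b \<otimes> z) [^] k))"
    using finE E(2) zero by (intro sum.mono_neutral_right) auto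
  moreover have "\<dots> = (\<Sum>z\<in>Z. \<psi> (g \<otimes> b) * \<phi> (g \<otimes> b [^] k))"
  proof (rule sum.cong[OF refl])
    fix z assume z: "z \<in> Z"
    then have zG: "z \<in> carrier G" and comm: "b \<otimes> z = z \<otimes> b"
      using gb by (auto simp: group_center_def)
    have zk: "z [^] k \<in> Z"
      using z by (rule \<psi>.center_nat_pow_closed)
    have "\<psi> (g \<otimes> (b \<otimes> z)) = \<psi>.central_char z * \<psi> (g \<otimes> b)"
      using \<psi>.central_char_eq'[OF z, of "g \<otimes> b"] gb zG by (simp add: \<psi>.m_assoc)
    moreover have "\<phi> (g \<otimes> (b \<otimes> z) [^] k) = \<phi>.central_char z ^ k * \<phi> (g \<otimes> b [^] k)"
      using \<phi>.central_char_eq'[OF zk, of "g \<otimes> b [^] k"] gb zG z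
      by (simp add: \<psi>.pow_mult_distrib[OF comm] \<psi>.m_assoc \<phi>.central_char_pow)
    ultimately have "\<psi> (g \<otimes> (b \<otimes> z)) * \<phi> (g \<otimes> (b \<otimes> z) [^] k) =
        (\<psi>.central_char z * \<phi>.central_char z ^ k) * (\<psi> (g \<otimes> b) * \<phi> (g \<otimes> b [^] k))"
      by (simp add: mult_ac)
    then show "\<psi> (g \<otimes> (b \<otimes> z)) * \<phi> (g \<otimes> (b \<otimes> z) [^] k) = \<psi> (g \<otimes> b) * \<phi> (g \<otimes> b [^] k)"
      by (simp add: k[OF z])
  qed
  ultimately show ?thesis by simp
qed

section \<open>The ascent from \<open>E\<close> to its relative centre\<close>

context
  fixes k :: nat
  assumes k: "\<And>z. z \<in> Z \<Longrightarrow> \<psi>.central_char z * \<phi>.central_char z ^ k = 1"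
    and cop: "coprime k (Coset.order G)" "coprime (1 - int k) (int (Coset.order G))"
begin

text \<open>The inverse \<open>k'\<close> of \<open>k\<close> modulo the group order undoes
  \<open>k\<close>-th powers.\<close>

lemma pow_root:
  "\<exists>k'::nat. \<forall>x\<in>carrier G. (x [^] k) [^] k' = x"
proof -
  obtain k' where "[k * k' = 1] (mod Coset.order G)"
    using cong_solve_coprime_nat[OF cop(1)] by auto
  then have "(x [^] k) [^] k' = x" if "x \<in> carrier G" for x
    using \<psi>.nat_pow_cong_order[OF \<psi>.fin that] that by (simp add: \<psi>.nat_pow_pow)
  then show ?thesis by blast
qed

text \<open>With \<open>b = d [^] j\<close> this writes \<open>d\<close> as \<open>b\<close> to the
  power \<open>1 - k\<close>. Translating by the inverse of \<open>b [^] k\<close> therefore turns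
  \<open>b\<close> into \<open>d\<close>, and translating by \<open>inv b\<close> turns
  \<open>b [^] k\<close> into \<open>inv d\<close>.\<close>

lemma pow_split:
  "\<exists>j::nat. \<forall>d\<in>carrier G. d [^] j = (d [^] j) [^] k \<otimes> d"
proof -
  \<comment> \<open>\<open>j\<close> is the inverse of \<open>1 - k\<close> modulo the group order\<close>
  define n where "n = int (Coset.order G)"
  have n: "n > 0" using \<psi>.ordG_nonzero by (simp add: n_def)
  obtain y where "[(1 - int k) * y = 1] (mod n)"
    using cong_solve_coprime_int[OF cop(2)] by (auto simp: n_def)
  moreover have "[(1 - int k) * (y mod n) = (1 - int k) * y] (mod n)"
    by (intro cong_mult cong_refl) (simp add: cong_def)
  moreover define j where "j = nat (y mod n)"
  ultimately have "[(1 - int k) * int j = 1] (mod n)"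
    using n by (auto intro: cong_trans)
  from cong_add[OF this cong_refl, of "int j * int k"]
  have "[int j = int (j * k + 1)] (mod n)" by (simp add: algebra_simps)
  then have "[j = j * k + 1] (mod Coset.order G)" unfolding n_def cong_int_iff .
  then have "d [^] j = d [^] (j * k + 1)" if "d \<in> carrier G" for d
    by (rule \<psi>.nat_pow_cong_order[OF \<psi>.fin that])
  moreover have "d [^] (j * k + 1) = (d [^] j) [^] k \<otimes> d" if "d \<in> carrier G" for d
    using that by (simp add: \<psi>.nat_pow_pow)
  ultimately have "d [^] j = (d [^] j) [^] k \<otimes> d" if "d \<in> carrier G" for d
    using that by metis
  then show ?thesis by blast
qed

text \<open>The two translations by powers of \<open>b = d [^] j\<close> reduce the claim for
  \<open>d\<close> outside \<open>E\<close> to \<open>R b = 0\<close>. The case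
  \<open>g = \<one>\<close> first shows that \<open>\<psi>\<close> vanishes on the relative centre
  outside \<open>E\<close>, and this kills every term of \<open>R b\<close>.\<close>

lemma sparse_on_relative_center:
  assumes E: "E \<lhd> G" "Z \<subseteq> E" and sparse: "sparse_on E"
  shows "sparse_on (\<psi>.relative_center E)"
proof -
  let ?A = "\<psi>.relative_center E"
  interpret E: normal E G by fact
  interpret A: normal ?A G by (rule \<psi>.relative_center_normal) fact
  have EA: "E \<subseteq> ?A" by (rule \<psi>.subset_relative_center) fact
  obtain k' :: nat where k': "\<And>x. x \<in> carrier G \<Longrightarrow> (x [^] k) [^] k' = x"
    using pow_root by blast
  obtain j :: nat where j: "\<And>d. d \<in> carrier G \<Longrightarrow> d [^] j = (d [^] j) [^] k \<otimes> d"
    using pow_split by blast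
  define R where "R b = (\<Sum>e\<in>E. \<psi> (b \<otimes> e) * \<phi> ((b \<otimes> e) [^] k))" for b
  have root_in_E: "x \<in> E" if "x \<in> carrier G" "x [^] k \<in> E" for x
    using \<psi>.subgroup_nat_pow_closed[OF E.is_subgroup that(2), of k'] k'[OF that(1)] by simp
  \<comment> \<open>Taking \<open>k'\<close>-th powers recovers \<open>b \<otimes> e\<close> from
    its \<open>k\<close>-th power. Hence for \<open>e\<close> outside \<open>Z\<close> the
    correction to \<open>b [^] k\<close> is also outside \<open>Z\<close>, and \<open>sparse\<close>
    applies to it.\<close>
  have shift: "e \<in> Z" if "b \<in> carrier G" "e \<in> E" "(b \<otimes> e) [^] k = b [^] k \<otimes> z" "z \<in> Z" for b e z
  proof -
    have cl: "e \<in> carrier G" "z \<in> carrier G" using that by (auto simp: group_center_def)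
    have "b [^] k \<otimes> z = z \<otimes> b [^] k" using that(1,4) unfolding group_center_def by auto
    then have "(b [^] k \<otimes> z) [^] k' = (b [^] k) [^] k' \<otimes> z [^] k'"
      using that(1) cl by (intro \<psi>.pow_mult_distrib) auto
    then have "b \<otimes> e = b \<otimes> z [^] k'"
      using k'[of "b \<otimes> e"] k'[of b] that(1) cl unfolding that(3) by simp
    then have "e = z [^] k'" using that(1) cl by simp
    then show ?thesis using \<psi>.center_nat_pow_closed[OF that(4)] by simp
  qed
  have b_props: "d [^] j \<in> ?A" "d [^] j \<notin> E" "inv ((d [^] j) [^] k) \<otimes> d [^] j = d"
      "inv (d [^] j) \<otimes> (d [^] j) [^] k = inv d"
    if d: "d \<in> ?A" "d \<notin> E" for d
  proof -
    have dG: "d \<in> carrier G" using d by simp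
    show "d [^] j \<in> ?A" by (rule \<psi>.subgroup_nat_pow_closed[OF A.is_subgroup d(1)])
    show *: "inv ((d [^] j) [^] k) \<otimes> d [^] j = d"
      using dG arg_cong[OF j[OF dG], of "\<lambda>x. inv ((d [^] j) [^] k) \<otimes> x"]
      by (simp add: \<psi>.mult_inv_cancel)
    show "d [^] j \<notin> E"
    proof
      assume "d [^] j \<in> E"
      then have "inv ((d [^] j) [^] k) \<otimes> d [^] j \<in> E"
        using \<psi>.subgroup_nat_pow_closed[OF E.is_subgroup] by simp
      then show False using * d by simp
    qed
    show "inv (d [^] j) \<otimes> (d [^] j) [^] k = inv d"
      using arg_cong[OF *, of "m_inv G"] dG by (simp add: \<psi>.inv_mult_group)
  qed
  \<comment> \<open>After this translation the argument of \<open>\<phi>\<close> is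
    \<open>g \<otimes> e'\<close> with \<open>e'\<close> in \<open>E\<close>, so sparseness for
    \<open>\<phi>\<close> removes the terms off \<open>Z\<close>.\<close>
  have psi_sum: "of_nat (card Z) * (\<psi> (g \<otimes> d) * \<phi> g) =
      \<chi> (g \<otimes> inv ((d [^] j) [^] k)) / \<chi> \<one> * R (d [^] j)"
    if g: "g \<in> carrier G" "\<chi> g \<noteq> 0" and d: "d \<in> ?A" "d \<notin> E" for g d
  proof -
    define b where "b = d [^] j"
    have cl: "b \<in> carrier G" "d \<in> carrier G" using d by (simp_all add: b_def)
    have "of_nat (card Z) * (\<psi> (g \<otimes> inv (b [^] k) \<otimes> b) * \<phi> (g \<otimes> inv (b [^] k) \<otimes> b [^] k)) =
      \<chi> (g \<otimes> inv (b [^] k)) / \<chi> \<one> * R b"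
      unfolding R_def
    proof (rule coset_sum[OF k E])
      fix e assume e: "e \<in> E - Z"
      obtain e' where e': "e' \<in> E" "(b \<otimes> e) [^] k = b [^] k \<otimes> e'"
        using \<psi>.coset_nat_pow[OF E(1) cl(1), of e k] e by auto
      then have "e' \<in> E - Z" using shift[OF cl(1)] e by blast
      then have "\<phi> (g \<otimes> e') = 0" using sparse g by (auto simp: sparse_on_def)
      then show "\<psi> (g \<otimes> inv (b [^] k) \<otimes> (b \<otimes> e)) * \<phi> (g \<otimes> inv (b [^] k) \<otimes> (b \<otimes> e) [^] k) = 0"
        using g cl e' by (simp add: \<psi>.m_assoc \<psi>.mult_inv_cancel)
    qed (use g cl b_props(1)[OF d] in \<open>auto simp: b_def\<close>)
    then show ?thesis using g cl b_props(3)[OF d] by (simp add: \<psi>.m_assoc b_def)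
  qed
  have psi_zero: "\<psi> d = 0" if d: "d \<in> ?A" "d \<notin> E" for d
  proof -
    have cl: "d \<in> carrier G" using d by simp
    have "inv ((d [^] j) [^] k) \<in> ?A"
      using \<psi>.subgroup_nat_pow_closed[OF A.is_subgroup] d by simp
    \<comment> \<open>Otherwise \<open>b [^] k\<close> would lie in \<open>E\<close>, and then so
      would its root \<open>b\<close>.\<close>
    moreover have "inv ((d [^] j) [^] k) \<notin> Z"
    proof
      assume "inv ((d [^] j) [^] k) \<in> Z"
      then have "inv (inv ((d [^] j) [^] k)) \<in> E" using E.m_inv_closed E(2) by blast
      then show False using root_in_E[of "d [^] j"] b_props(2)[OF d] cl by simp
    qed
    ultimately have "\<chi> (inv ((d [^] j) [^] k)) = 0"
      using vanish_on_relative_center[OF E(1) sparse] by blast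
    then have "of_nat (card Z) * (\<psi> d * \<phi> \<one>) = 0"
      using psi_sum[of \<one> d] d cl by simp
    then show ?thesis using \<psi>.card_center_pos by simp
  qed
  have R_zero: "R b = 0" if b: "b \<in> ?A" "b \<notin> E" for b
    unfolding R_def
  proof (rule sum.neutral, rule ballI)
    fix e assume e: "e \<in> E"
    have "b \<otimes> e \<notin> E"
    proof
      assume "b \<otimes> e \<in> E"
      then have "(b \<otimes> e) \<otimes> inv e \<in> E" using e by simp
      then show False using b e by (simp add: \<psi>.m_assoc)
    qed
    then show "\<psi> (b \<otimes> e) * \<phi> ((b \<otimes> e) [^] k) = 0"
      using psi_zero[of "b \<otimes> e"] b e EA by auto
  qed
  have psi: "\<psi> (g \<otimes> d) = 0" if g: "g \<in> carrier G" "\<chi> g \<noteq> 0" and d: "d \<in> ?A" "d \<notin> E" for g d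
    using psi_sum[OF g d] R_zero[OF b_props(1,2)[OF d]] g \<psi>.card_center_pos char_nonzero_iff[OF g(1)]
    by simp
  \<comment> \<open>Mirror image of \<open>psi_sum\<close>: translating by \<open>inv b\<close>
    leaves \<open>\<psi> (g \<otimes> e)\<close>, and sparseness for \<open>\<psi>\<close> removes
    the terms off \<open>Z\<close>.\<close>
  have phi: "\<phi> (g \<otimes> inv d) = 0" if g: "g \<in> carrier G" "\<chi> g \<noteq> 0" and d: "d \<in> ?A" "d \<notin> E" for g d
  proof -
    define b where "b = d [^] j"
    have cl: "b \<in> carrier G" "d \<in> carrier G" using d by (simp_all add: b_def)
    have "of_nat (card Z) * (\<psi> (g \<otimes> inv b \<otimes> b) * \<phi> (g \<otimes> inv b \<otimes> b [^] k)) =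
      \<chi> (g \<otimes> inv b) / \<chi> \<one> * R b"
      unfolding R_def
    proof (rule coset_sum[OF k E])
      fix e assume e: "e \<in> E - Z"
      then have "\<psi> (g \<otimes> e) = 0" using sparse g by (auto simp: sparse_on_def)
      then show "\<psi> (g \<otimes> inv b \<otimes> (b \<otimes> e)) * \<phi> (g \<otimes> inv b \<otimes> (b \<otimes> e) [^] k) = 0"
        using g cl e by (simp add: \<psi>.m_assoc \<psi>.mult_inv_cancel)
    qed (use g cl b_props(1)[OF d] in \<open>auto simp: b_def\<close>)
    then show ?thesis
      using g cl b_props(4)[OF d] R_zero[OF b_props(1,2)[OF d]] \<psi>.card_center_pos char_nonzero_iff[OF g(1)]
      by (simp add: \<psi>.m_assoc b_def)
  qed
  show ?thesis
    unfolding sparse_on_def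
  proof (intro ballI impI)
    fix g d assume g: "g \<in> carrier G" "\<chi> g \<noteq> 0" and d: "d \<in> ?A - Z"
    show "\<psi> (g \<otimes> d) = 0 \<and> \<phi> (g \<otimes> d) = 0"
    proof (cases "d \<in> E")
      case True
      then show ?thesis using sparse g d by (auto simp: sparse_on_def)
    next
      case False
      then have "inv d \<in> ?A" "inv d \<notin> E"
        using d E.m_inv_closed[of "inv d"] by auto
      then show ?thesis using psi[OF g] phi[OF g] d False A.subset by (metis DiffD1 \<psi>.inv_inv subsetD)
    qed
  qed
qed

end

text \<open>Some noncentral \<open>b\<close> has central commutators of order dividing
  \<open>p\<close>, not all trivial. A \<open>k\<close> divisible by \<open>p\<close> would make
  \<open>\<psi>.central_char\<close> trivial on them, against faithfulness; \<open>k\<close>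
  congruent to \<open>1\<close> would contradict \<open>\<chi> b = 0\<close>.\<close>

lemma exponent_coprime:
  assumes p: "prime p" and ord: "Coset.order G = p ^ a" and Z: "Z \<noteq> carrier G"
    and k: "\<And>z. z \<in> Z \<Longrightarrow> \<psi>.central_char z * \<phi>.central_char z ^ k = 1"
  shows "coprime k (Coset.order G)" "coprime (1 - int k) (int (Coset.order G))"
proof -
  interpret A: normal "\<psi>.relative_center Z" G
    by (intro \<psi>.relative_center_normal \<psi>.normal_center)
  obtain x where x: "x \<in> \<psi>.relative_center Z" "x \<notin> Z"
    using \<psi>.p_group_relative_center_larger[OF p ord \<psi>.normal_center Z] by blast
  \<comment> \<open>pass to a power \<open>b\<close> of \<open>x\<close> outside \<open>Z\<close> with \<open>b\<^sup>p \<in> Z\<close>, so that its commutators have order dividing \<open>p\<close>\<close>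
  define i where "i = (LEAST i. x [^] (p ^ i) \<in> Z)"
  have ex: "x [^] (p ^ a) \<in> Z"
    using \<psi>.pow_order_eq_1[of x] x ord subgroup.one_closed[OF \<psi>.subgroup_center] by simp
  have iZ: "x [^] (p ^ i) \<in> Z" unfolding i_def by (rule LeastI) (rule ex)
  have "i \<noteq> 0" using iZ x by (intro notI) simp
  define b where "b = x [^] (p ^ (i - 1))"
  have bG: "b \<in> carrier G" using x by (simp add: b_def)
  have bA: "b \<in> \<psi>.relative_center Z"
    unfolding b_def by (rule \<psi>.subgroup_nat_pow_closed[OF A.is_subgroup x(1)])
  have bZ: "b \<notin> Z"
    using not_less_Least[of "i - 1" "\<lambda>i. x [^] (p ^ i) \<in> Z"] \<open>i \<noteq> 0\<close> by (simp add: b_def i_def[symmetric])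
  have "b [^] p = x [^] (p ^ (i - 1) * p)" using x by (simp add: b_def \<psi>.nat_pow_pow)
  also have "p ^ (i - 1) * p = p ^ i" using \<open>i \<noteq> 0\<close> by (cases i) simp_all
  finally have bp: "b [^] p \<in> Z" using iZ by simp
  define c where "c h = h \<otimes> b \<otimes> inv h \<otimes> inv b" for h
  have cZ: "c h \<in> Z" if "h \<in> carrier G" for h
    using bA that unfolding \<psi>.relative_center_def c_def by blast
  have cG: "c h \<in> carrier G" if "h \<in> carrier G" for h
    using bG that by (simp add: c_def)
  have conj: "h \<otimes> b \<otimes> inv h = c h \<otimes> b" if "h \<in> carrier G" for h
    using bG that by (simp add: c_def \<psi>.m_assoc)
  have cp: "c h [^] p = \<one>" if h: "h \<in> carrier G" for h
  proof -
    have "c h \<otimes> b = b \<otimes> c h" using cZ[OF h] bG unfolding group_center_def by blast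
    \<comment> \<open>Since \<open>c h\<close> is central and \<open>b [^] p\<close> is central,
      comparing the \<open>p\<close>-th powers of \<open>c h \<otimes> b\<close> and of the
      conjugate of \<open>b\<close> leaves \<open>c h [^] p = \<one>\<close>.\<close>
    then have "c h [^] p \<otimes> b [^] p = (h \<otimes> b \<otimes> inv h) [^] p"
      unfolding conj[OF h] by (intro \<psi>.pow_mult_distrib[symmetric] cG[OF h] bG)
    also have "\<dots> = h \<otimes> b [^] p \<otimes> inv h" by (rule \<psi>.conj_nat_pow[OF h bG])
    also have "h \<otimes> b [^] p = b [^] p \<otimes> h" using bp h unfolding group_center_def by auto
    also have "b [^] p \<otimes> h \<otimes> inv h = b [^] p" using h bG by (simp add: \<psi>.m_assoc)
    finally show ?thesis using bG cG[OF h] by simp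
  qed
  have "\<exists>h\<in>carrier G. c h \<noteq> \<one>"
  proof (rule ccontr)
    assume no: "\<not> ?thesis"
    have "b \<otimes> h = h \<otimes> b" if h: "h \<in> carrier G" for h
      using conj[OF h] no h bG \<psi>.inv_solve_right'[of b "h \<otimes> b" h] by auto
    then show False using bG bZ unfolding group_center_def by blast
  qed
  then obtain h where h: "h \<in> carrier G" "c h \<noteq> \<one>" by blast
  have \<psi>c: "\<psi>.central_char (c h) \<noteq> 1" using \<psi>.central_char_injective[OF faithful(1) cZ[OF h(1)]] h(2) by blast
  \<comment> \<open>The conjugate \<open>c h \<otimes> b\<close> has the same character value as
    \<open>b\<close>, but a scalar other than \<open>1\<close> in front.\<close>
  have "\<psi> b = \<psi>.central_char (c h) * \<psi> b"
    using \<psi>.char_conj[OF bG h(1)] \<psi>.central_char_eq[OF cZ[OF h(1)] bG] conj[OF h(1)] by simp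
  then have "\<psi> b = 0" using \<psi>c by simp
  then have \<chi>b: "\<chi> b = 0" using char_nonzero_iff[OF bG] by blast
  have \<phi>p: "\<phi>.central_char (c h) ^ p = 1" if "h \<in> carrier G" for h
    using cp[OF that] \<phi>.central_char_pow[OF cZ[OF that], of p] by (simp add: \<phi>.central_char_one)
  have "\<not> p dvd k"
  proof
    assume "p dvd k"
    then obtain r where "k = p * r" by blast
    then have "\<phi>.central_char (c h) ^ k = 1" using \<phi>p[OF h(1)] by (simp add: power_mult)
    then show False using k[OF cZ[OF h(1)]] \<psi>c by simp
  qed
  then have "coprime k p"
    using p prime_imp_coprime coprime_commute by metis
  then show "coprime k (Coset.order G)" by (simp add: ord)
  \<comment> \<open>otherwise \<open>\<lambda>\<mu>\<close> kills all commutators of \<open>b\<close>, so \<open>\<bar>\<chi>(b)\<bar> = \<chi>(1)\<close>, whereas \<open>\<chi>(b) = 0\<close>\<close>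
  have "\<not> int p dvd 1 - int k"
  proof
    assume "int p dvd 1 - int k"
    then have "[1 = int k] (mod int p)" by (simp add: cong_iff_dvd_diff)
    then have "k mod p = 1 mod p" by (metis cong_def cong_int_iff of_nat_1)
    moreover have "1 mod p = 1" using prime_gt_1_nat[OF p] by simp
    ultimately have kp: "k = p * (k div p) + 1" by (metis mult_div_mod_eq)
    have "\<chi> (c g) = \<chi> \<one>" if g: "g \<in> carrier G" for g
    proof -
      have "\<phi>.central_char (c g) ^ k = \<phi>.central_char (c g)"
        by (subst kp) (simp add: power_add power_mult \<phi>p[OF g])
      then have "\<psi>.central_char (c g) * \<phi>.central_char (c g) = 1" using k[OF cZ[OF g]] by simp
      moreover have "\<psi> (c g) = \<psi>.central_char (c g) * \<psi> \<one>" "\<phi> (c g) = \<phi>.central_char (c g) * \<phi> \<one>"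
        by (simp_all add: \<psi>.central_char_def \<phi>.central_char_def)
      ultimately have "\<psi> (c g) * \<phi> (c g) = \<psi> \<one> * \<phi> \<one>" by simp
      then show ?thesis using product[OF cG[OF g]] product[of \<one>] m_pos by simp
    qed
    then have "(\<Sum>g\<in>carrier G. \<chi> (g \<otimes> b \<otimes> inv g \<otimes> inv b)) = \<psi>.ordG * \<chi> \<one>"
      by (simp add: c_def Coset.order_def)
    \<comment> \<open>The class sum relation evaluates the same sum to a multiple of
      \<open>\<chi> b\<close>, that is, to zero.\<close>
    then show False using \<chi>.char_class_sum[OF bG, of "inv b"] bG \<chi>b \<psi>.ordG_nonzero by simp
  qed
  moreover have "prime (int p)" using p by simp
  ultimately have "coprime (1 - int k) (int p)"
    using prime_imp_coprime coprime_commute by metis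
  then show "coprime (1 - int k) (int (Coset.order G))" by (simp add: ord)
qed

text \<open>A maximal sparse normal subgroup above \<open>Z\<close> replaces induction along the
  series: it equals its own relative centre, hence is all of \<open>G\<close>.\<close>

lemma p_group_vanish_off_center:
  assumes p: "prime p" and ord: "Coset.order G = p ^ a"
    and b: "b \<in> carrier G - Z"
  shows "\<psi> b = 0 \<and> \<phi> b = 0"
proof -
  have Z: "Z \<noteq> carrier G" using b by blast
  obtain k where k: "\<And>z. z \<in> Z \<Longrightarrow> \<psi>.central_char z * \<phi>.central_char z ^ k = 1"
    using complementary_exponent by blast
  have cop: "coprime k (Coset.order G)" "coprime (1 - int k) (int (Coset.order G))"
    using exponent_coprime[OF p ord Z, of k] k by blast+
  define S where "S = {E. E \<lhd> G \<and> Z \<subseteq> E \<and> sparse_on E}"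
  have "S \<subseteq> Pow (carrier G)" using normal_imp_subgroup subgroup.subset by (fastforce simp: S_def)
  then have "finite S" using \<psi>.fin finite_subset by blast
  moreover have "Z \<in> S" using \<psi>.normal_center by (simp add: S_def sparse_on_def)
  ultimately obtain E where E: "E \<in> S" "\<And>F. F \<in> S \<Longrightarrow> E \<subseteq> F \<Longrightarrow> E = F"
    using finite_has_maximal[of S] by blast
  then have E': "E \<lhd> G" "Z \<subseteq> E" "sparse_on E" by (auto simp: S_def)
  have sub: "E \<subseteq> \<psi>.relative_center E" by (rule \<psi>.subset_relative_center) fact
  then have "\<psi>.relative_center E \<in> S"
    using sparse_on_relative_center[OF _ cop E'] k \<psi>.relative_center_normal[OF E'(1)] E'(2)
    by (auto simp: S_def)
  then have "E = \<psi>.relative_center E" using E(2) sub by blast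
  then have "E = carrier G"
    using \<psi>.p_group_relative_center_larger[OF p ord E'(1)] by blast
  then show ?thesis
    using E'(3) b unfolding sparse_on_def by (metis DiffD1 \<chi>.degree_nonzero \<psi>.l_one \<psi>.one_closed)
qed

end

theorem theoremB:
  fixes G :: "('a, 'c) monoid_scheme"
    and p a m :: nat
    and \<psi> \<phi> \<chi> :: "'a \<Rightarrow> complex"
  assumes "prime p"
    and "group G"
    and "finite (carrier G)"
    and "Coset.order G = p ^ a"
    and "\<psi> \<in> Irr G" and "faithful_char G \<psi>"
    and "\<phi> \<in> Irr G" and "faithful_char G \<phi>"
    and "\<chi> \<in> Irr G" and "m > 0"
    and "\<forall>g\<in>carrier G. \<psi> g * \<phi> g = of_nat m * \<chi> g"
  shows "fully_ramified G \<psi> \<and> fully_ramified G \<phi> \<and>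
         (\<forall>g\<in>carrier G - group_center G. \<psi> g = 0 \<and> \<phi> g = 0)"
proof -
  interpret group G by fact
  interpret faithful_irr_product G \<psi> \<phi> \<chi> m
    by unfold_locales (use assms in auto)
  note vanish = p_group_vanish_off_center[OF assms(1,4)]
  show ?thesis
    using vanish \<psi>.fully_ramified_if_vanishing_off_center \<phi>.fully_ramified_if_vanishing_off_center by blast
qed

end
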